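(* Let $\Gamma$ be a free group on $p\ge 2$ generators acting convex co-compactly on a $\mathrm{CAT}(-1)$ space $(X,d)$, let $o\in X$ be an arbitrary base point, and let $|\cdot|$ be word length on $\Gamma$ with respect to a fixed free generating set $\mathcal A=\{a_1,\dots,a_p\}$. Write $\Gamma_n=\{x\in\Gamma : |x|=n\}$ and let $$\lambda=\lim_{n\to\infty}\frac{1}{\#\Gamma_n}\sum_{x\in\Gamma_n}\frac{d(o,xo)}{n}>0 .$$ Suppose that the set $\{d(o,xo)-\lambda|x| : x\in\Gamma\}$ is not bounded. Let $\sigma^2>0$ be the variance for which the distribution of $(d(o,xo)-\lambda n)/\sqrt n$ with respect to the normalised counting measure on $\Gamma_n$ converges to the normal distribution $N(0,\sigma^2)$ as $n\to\infty$, and let $\sigma>0$ be its square root. Let $\mathfrak C$ be a non-trivial conjugacy class in $\Gamma$, let $k=\min\{|x| : x\in\mathfrak C\}$, and let $\mathfrak C_n=\{x\in\mathfrak C : |x|=n\}$. Then the distribution of $(d(o,xo)-\lambda(k+2m))/\sqrt{k+2m}$ with respect to the normalised counting measure on $\mathfrak C_{k+2m}$ converges to the normal distribution $N(0,2\sigma^2)$ as $m\to\infty$, i.e. for every $y\in\mathbb R$, $$\lim_{m\to\infty}\frac{1}{\#\mathfrak C_{k+2m}}\#\left\{x\in\mathfrak C_{k+2m} : \frac{d(o,xo)-\lambda(k+2m)}{\sqrt{k+2m}}<y\right\}=\frac{1}{2\sqrt{\pi}\,\sigma}\int_{-\infty}^{y}e^{-t^2/4\sigma^2}\,dt .$$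
   Context: The action of $\Gamma$ on $X$ is by isometries and properly discontinuous. It is convex co-compact if the quotient by $\Gamma$ of the intersection of $X$ with the convex hull of the limit set of $\Gamma$ is compact. In this situation (Švarc–Milnor) there are constants $C_1,C_2>0$ with $C_1|x|\le d(o,xo)\le C_2|x|$ for all $x\in\Gamma$. It is known that the limit defining $\lambda$ exists and is positive, and that, when $\{d(o,xo)-\lambda|x| : x\in\Gamma\}$ is not bounded, the unrestricted central limit theorem over $\Gamma_n$ used to define $\sigma^2$ holds with a finite $\sigma^2>0$. The set $\mathfrak C_n$ is non-empty if and only if $n=k+2m$ for some integer $m\ge 0$. A conjugacy class is non-trivial if it is not $\{1\}$. *)

theory Defs
  imports "HOL-Probability.Probability" "HOL-Algebra.Group_Action"
begin

section \<open>Free groups, word length, conjugacy classes\<close>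

text \<open>
  The letter \<open>(a, True)\<close> stands for the generator \<open>a\<close> and \<open>(a, False)\<close> for its inverse.
\<close>

definition letter_val :: "('g, 'b) monoid_scheme \<Rightarrow> 'g \<times> bool \<Rightarrow> 'g" where
  "letter_val G l = (if snd l then fst l else inv\<^bsub>G\<^esub> (fst l))"

definition word_val :: "('g, 'b) monoid_scheme \<Rightarrow> ('g \<times> bool) list \<Rightarrow> 'g" where
  "word_val G w = foldr (\<otimes>\<^bsub>G\<^esub>) (map (letter_val G) w) \<one>\<^bsub>G\<^esub>"

definition group_words :: "'g set \<Rightarrow> ('g \<times> bool) list set" where
  "group_words A = lists (A \<times> UNIV)"

definition reduced_word :: "('g \<times> bool) list \<Rightarrow> bool" where
  "reduced_word w \<longleftrightarrow> successively (\<lambda>l l'. \<not> (fst l = fst l' \<and> snd l \<noteq> snd l')) w"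

text \<open>
  \<open>A\<close> freely generates \<open>G\<close>: every element is the value of exactly one reduced word.
\<close>

definition free_generating_set :: "('g, 'b) monoid_scheme \<Rightarrow> 'g set \<Rightarrow> bool" where
  "free_generating_set G A \<longleftrightarrow>
     A \<subseteq> carrier G \<and>
     bij_betw (word_val G) {w \<in> group_words A. reduced_word w} (carrier G)"

definition word_length :: "('g, 'b) monoid_scheme \<Rightarrow> 'g set \<Rightarrow> 'g \<Rightarrow> nat" where
  "word_length G A x = (LEAST n. \<exists>w \<in> group_words A. length w = n \<and> word_val G w = x)"

definition word_sphere :: "('g, 'b) monoid_scheme \<Rightarrow> 'g set \<Rightarrow> nat \<Rightarrow> 'g set" where
  "word_sphere G A n = {x \<in> carrier G. word_length G A x = n}"

definition conjugacy_class :: "('g, 'b) monoid_scheme \<Rightarrow> 'g \<Rightarrow> 'g set" where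
  "conjugacy_class G x = {h \<otimes>\<^bsub>G\<^esub> x \<otimes>\<^bsub>G\<^esub> inv\<^bsub>G\<^esub> h | h. h \<in> carrier G}"

definition conjugacy_classes :: "('g, 'b) monoid_scheme \<Rightarrow> 'g set set" where
  "conjugacy_classes G = conjugacy_class G ` carrier G"


section \<open>CAT(-1) spaces\<close>

definition geodesic_on :: "real set \<Rightarrow> (real \<Rightarrow> 'x::metric_space) \<Rightarrow> bool" where
  "geodesic_on I c \<longleftrightarrow> (\<forall>s\<in>I. \<forall>t\<in>I. dist (c s) (c t) = \<bar>s - t\<bar>)"

definition geodesic_segment :: "'x::metric_space \<Rightarrow> 'x \<Rightarrow> (real \<Rightarrow> 'x) \<Rightarrow> bool" where
  "geodesic_segment x y c \<longleftrightarrow> geodesic_on {0..dist x y} c \<and> c 0 = x \<and> c (dist x y) = y"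

text \<open>The hyperbolic plane of curvature -1, as the upper half-plane.\<close>

definition upper_half_plane :: "complex set" where
  "upper_half_plane = {z. Im z > 0}"

definition hyp_dist :: "complex \<Rightarrow> complex \<Rightarrow> real" where
  "hyp_dist z w = arcosh (1 + (cmod (z - w))\<^sup>2 / (2 * Im z * Im w))"

text \<open>
  The CAT(-1) inequality \<open>d(u, v) \<le> d(u', v')\<close> for points \<open>u\<close>, \<open>v\<close> on the sides of a geodesic
  triangle and their comparison points on a comparison triangle \<open>x' y' z'\<close>.  Any two sides share
  a vertex, here called \<open>x\<close>, and the inequality is an equality for two points of the same side;
  the third side does not enter.  The comparison point \<open>u'\<close> of \<open>u = c s\<close> is the point of the
  segment \<open>[x', y']\<close> at distance \<open>s\<close> from \<open>x'\<close>.
\<close>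

definition CAT_minus_one :: "'x::metric_space itself \<Rightarrow> bool" where
  "CAT_minus_one _ \<longleftrightarrow>
     (\<forall>x y::'x. \<exists>c. geodesic_segment x y c) \<and>
     (\<forall>(x::'x) y z c e. \<forall>s\<in>{0..dist x y}. \<forall>t\<in>{0..dist x z}.
        \<forall>x'\<in>upper_half_plane. \<forall>y'\<in>upper_half_plane. \<forall>z'\<in>upper_half_plane.
        \<forall>u'\<in>upper_half_plane. \<forall>v'\<in>upper_half_plane.
          geodesic_segment x y c \<and> geodesic_segment x z e \<and>
          hyp_dist x' y' = dist x y \<and> hyp_dist x' z' = dist x z \<and> hyp_dist y' z' = dist y z \<and>
          hyp_dist x' u' = s \<and> hyp_dist u' y' = dist x y - s \<and>
          hyp_dist x' v' = t \<and> hyp_dist v' z' = dist x z - t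
          \<longrightarrow> dist (c s) (e t) \<le> hyp_dist u' v')"


section \<open>Boundary at infinity and convexity\<close>

definition geodesic_ray :: "(real \<Rightarrow> 'x::metric_space) \<Rightarrow> bool" where
  "geodesic_ray c \<longleftrightarrow> geodesic_on {0..} c"

definition geodesic_line :: "(real \<Rightarrow> 'x::metric_space) \<Rightarrow> bool" where
  "geodesic_line c \<longleftrightarrow> geodesic_on UNIV c"

definition asymptotic :: "(real \<Rightarrow> 'x::metric_space) \<Rightarrow> (real \<Rightarrow> 'x) \<Rightarrow> bool" where
  "asymptotic c c' \<longleftrightarrow> bounded ((\<lambda>t. dist (c t) (c' t)) ` {0..})"

text \<open>
  A point of the boundary at infinity is a class of asymptotic geodesic rays.  The class depends
  only on the restriction of \<open>c\<close> to \<open>{0..}\<close>, so it also makes sense for the positive half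
  of a geodesic line.
\<close>

definition ideal_point :: "(real \<Rightarrow> 'x::metric_space) \<Rightarrow> (real \<Rightarrow> 'x) set" where
  "ideal_point c = {c'. geodesic_ray c' \<and> asymptotic c c'}"

text \<open>
  Geodesic convexity of a subset of the space together with its boundary; \<open>Inl\<close> marks points
  of the space and \<open>Inr\<close> points of the boundary.  The three clauses concern segments, rays
  and lines.
\<close>

definition geod_convex :: "('x::metric_space + (real \<Rightarrow> 'x) set) set \<Rightarrow> bool" where
  "geod_convex S \<longleftrightarrow>
     (\<forall>x y c. Inl x \<in> S \<and> Inl y \<in> S \<and> geodesic_segment x y c
        \<longrightarrow> Inl ` c ` {0..dist x y} \<subseteq> S) \<and>
     (\<forall>c. geodesic_ray c \<and> Inl (c 0) \<in> S \<and> Inr (ideal_point c) \<in> S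
        \<longrightarrow> Inl ` c ` {0..} \<subseteq> S) \<and>
     (\<forall>c. geodesic_line c \<and> Inr (ideal_point c) \<in> S \<and> Inr (ideal_point (\<lambda>t. c (- t))) \<in> S
        \<longrightarrow> Inl ` range c \<subseteq> S)"

definition gromov_product :: "'x::metric_space \<Rightarrow> 'x \<Rightarrow> 'x \<Rightarrow> real" where
  "gromov_product b x y = (dist b x + dist b y - dist x y) / 2"

text \<open>
  Convergence of a sequence in the space to the boundary point represented by the ray \<open>c\<close>;
  it does not depend on \<open>b\<close>.
\<close>

definition tends_to_ideal :: "'x::metric_space \<Rightarrow> (nat \<Rightarrow> 'x) \<Rightarrow> (real \<Rightarrow> 'x) \<Rightarrow> bool" where
  "tends_to_ideal b s c \<longleftrightarrow>
     filterlim (\<lambda>(n, t). gromov_product b (s n) (c t)) at_top (sequentially \<times>\<^sub>F at_top)"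


section \<open>Convex co-compact actions\<close>

definition isometric_action :: "('g, 'b) monoid_scheme \<Rightarrow> ('g \<Rightarrow> 'x::metric_space \<Rightarrow> 'x) \<Rightarrow> bool" where
  "isometric_action G act \<longleftrightarrow>
     group_action G UNIV act \<and>
     (\<forall>g \<in> carrier G. \<forall>x y. dist (act g x) (act g y) = dist x y)"

definition properly_discontinuous ::
    "('g, 'b) monoid_scheme \<Rightarrow> ('g \<Rightarrow> 'x::metric_space \<Rightarrow> 'x) \<Rightarrow> bool" where
  "properly_discontinuous G act \<longleftrightarrow>
     (\<forall>K. compact K \<longrightarrow> finite {g \<in> carrier G. act g ` K \<inter> K \<noteq> {}})"

definition limit_set ::
    "('g, 'b) monoid_scheme \<Rightarrow> ('g \<Rightarrow> 'x::metric_space \<Rightarrow> 'x) \<Rightarrow> 'x \<Rightarrow> (real \<Rightarrow> 'x) set set" where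
  "limit_set G act b =
     {ideal_point c | c. geodesic_ray c \<and>
        (\<exists>g. range g \<subseteq> carrier G \<and> tends_to_ideal b (\<lambda>n. act (g n) b) c)}"

definition convex_core ::
    "('g, 'b) monoid_scheme \<Rightarrow> ('g \<Rightarrow> 'x::metric_space \<Rightarrow> 'x) \<Rightarrow> 'x \<Rightarrow> 'x set" where
  "convex_core G act b = {x. Inl x \<in> geod_convex hull (Inr ` limit_set G act b)}"

text \<open>The quotient topology on the set of orbits of points of \<open>C\<close>.\<close>

definition orbit_space ::
    "('g, 'b) monoid_scheme \<Rightarrow> ('g \<Rightarrow> 'x::topological_space \<Rightarrow> 'x) \<Rightarrow> 'x set \<Rightarrow> 'x set topology" where
  "orbit_space G act C =
     topology (\<lambda>U. U \<subseteq> orbit G act ` C \<and> openin (top_of_set C) {x \<in> C. orbit G act x \<in> U})"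

lemma openin_orbit_space:
  "openin (orbit_space G act C) U \<longleftrightarrow>
     U \<subseteq> orbit G act ` C \<and> openin (top_of_set C) {x \<in> C. orbit G act x \<in> U}"
proof -
  let ?P = "\<lambda>U. U \<subseteq> orbit G act ` C \<and> openin (top_of_set C) {x \<in> C. orbit G act x \<in> U}"
  have "istopology ?P"
    unfolding istopology_def
  proof (intro conjI allI impI; (elim conjE)?)
    fix S T
    assume "openin (top_of_set C) {x \<in> C. orbit G act x \<in> S}"
      and "openin (top_of_set C) {x \<in> C. orbit G act x \<in> T}"
    moreover have "{x \<in> C. orbit G act x \<in> S \<inter> T} =
        {x \<in> C. orbit G act x \<in> S} \<inter> {x \<in> C. orbit G act x \<in> T}"
      by auto
    ultimately show "openin (top_of_set C) {x \<in> C. orbit G act x \<in> S \<inter> T}"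
      by (simp only: openin_Int)
  next
    fix \<K>
    assume K: "\<forall>K\<in>\<K>. ?P K"
    have "{x \<in> C. orbit G act x \<in> \<Union>\<K>} = (\<Union>K\<in>\<K>. {x \<in> C. orbit G act x \<in> K})"
      by auto
    with K show "openin (top_of_set C) {x \<in> C. orbit G act x \<in> \<Union>\<K>}"
      by (simp only:) blast
  qed blast+
  then show ?thesis
    by (simp add: orbit_space_def topology_inverse')
qed

text \<open>
  The hull is required to meet the space.  On a proper CAT(-1) space this only says that the limit
  set has more than one point.  The clause excludes actions fixing a single limit point, and
  incomplete spaces in which no geodesic joins limit points: there the quotient is empty, hence
  vacuously compact, and the orbit map need not be a quasi-isometric embedding.
\<close>

definition convex_cocompact ::
    "('g, 'b) monoid_scheme \<Rightarrow> ('g \<Rightarrow> 'x::metric_space \<Rightarrow> 'x) \<Rightarrow> 'x \<Rightarrow> bool" where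
  "convex_cocompact G act b \<longleftrightarrow>
     convex_core G act b \<noteq> {} \<and> compact_space (orbit_space G act (convex_core G act b))"


section \<open>Normalised displacement\<close>

text \<open>
  The distribution of \<open>(d(b, x b) - \<lambda> n) / \<surd>n\<close> for \<open>x\<close> uniformly distributed in \<open>F\<close>.
\<close>

definition displacement_distr ::
    "('g \<Rightarrow> 'x::metric_space \<Rightarrow> 'x) \<Rightarrow> 'x \<Rightarrow> real \<Rightarrow> 'g set \<Rightarrow> nat \<Rightarrow> real measure" where
  "displacement_distr act b lam F n =
     distr (uniform_count_measure F) borel (\<lambda>x. (dist b (act x b) - lam * real n) / sqrt (real n))"

end

theory Submission
  imports Defs "HOL-Real_Asymp.Real_Asymp"
begin

text \<open>
  An element of the conjugacy class of length \<open>k + 2 m\<close> is, in exactly one way, a product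
  \<open>u\<^sup>-\<^sup>1 z u\<close> without cancellation, where \<open>z\<close> is one of the finitely many cyclically reduced
  elements of the class (all of length \<open>k\<close>) and \<open>u\<close> has length \<open>m\<close>.  For fixed \<open>z\<close>, the absence
  of cancellation only restricts the first letter of \<open>u\<close> (\<open>conjugacy_class_sphere\<close>,
  \<open>reduced_conj_words_eq\<close>).

  The orbit of the base point along a reduced word is a quasi-geodesic with constants that do not
  depend on the word: the action is convex co-compact, so the displacement of \<open>x\<close> grows at least
  linearly in the length of \<open>x\<close> (\<open>svarc_milnor_lower_bound\<close>).  A CAT(-1) space is hyperbolic, and
  quasi-geodesics in it run close to geodesics
  (\<open>quasi_geodesic_gromov_product_bounded\<close>).  Applied to \<open>u\<^sup>-\<^sup>1 z u\<close> this gives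
  \<open>d(b, u\<^sup>-\<^sup>1 z u b) = 2 d(b, u b) + O(1)\<close> (\<open>conj_word_displacement\<close>).  Dividing the centred left side
  by \<open>\<surd>(k + 2 m)\<close> therefore gives, up to \<open>o(1)\<close>, the quantity \<open>(d(b, u b) - \<lambda> m) / \<surd>m\<close>
  multiplied by \<open>2 / \<surd>2 = \<surd>2\<close>.  This is where the factor 2 in the variance comes from.

  It remains to see that the central limit theorem for words \<open>u\<close> of length \<open>m\<close> still holds, with the
  same limit, when the first letter of \<open>u\<close> is prescribed (\<open>char_given_first_letter\<close>).  Let
  \<open>a\<^sub>l(n)\<close> be the characteristic function, at a fixed argument, of the normalised displacement of a
  random reduced word of length \<open>n\<close> that starts with \<open>l\<close>, and let \<open>q = 2 p - 1\<close>.  Deleting the first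
  letter changes the displacement by a bounded amount, and the remainder may start with any letter
  except \<open>l\<^sup>-\<^sup>1\<close>, so \<open>a\<^sub>l(n + 1) = (T(n) - a\<^bsub>l'\<^esub>(n)) / q + o(1)\<close> where \<open>l' = l\<^sup>-\<^sup>1\<close> and \<open>T(n)\<close> is the sum
  of all the \<open>a\<^sub>i(n)\<close>.  The unrestricted central limit theorem says that \<open>T(n) / (q + 1)\<close> converges
  to the characteristic function of the normal law; hence the distance of the \<open>a\<^sub>l\<close> from this limit
  contracts by the factor \<open>1 / q\<close> in each step, up to \<open>o(1)\<close>, and tends to \<open>0\<close>.  Averaging over the
  admissible pairs of \<open>z\<close> and a first letter, and Levy's continuity theorem, finish the proof.
\<close>

section \<open>Thin triangles in CAT(-1) spaces\<close>

text \<open>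
  Geodesic polar coordinates around \<open>\<i>\<close>: the point at distance \<open>s\<close> in direction \<open>\<theta>\<close>, obtained
  by applying the rotation about \<open>\<i>\<close> to the point \<open>\<i> e\<^sup>s\<close> of the vertical geodesic.  They make
  comparison triangles with prescribed sides explicit, since distances are then given by the
  hyperbolic law of cosines.
\<close>

definition polar_point :: "real \<Rightarrow> real \<Rightarrow> complex" where
  "polar_point s \<theta> = Complex (sinh s * sin \<theta> / (cosh s - sinh s * cos \<theta>))
                            (1 / (cosh s - sinh s * cos \<theta>))"

lemma polar_denominator_pos: "cosh s - sinh s * cos \<theta> > (0::real)"
proof -
  have "\<bar>sinh s * cos \<theta>\<bar> \<le> \<bar>sinh s\<bar>"
    using abs_cos_le_one[of \<theta>] by (simp add: abs_mult mult_left_le)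
  also have "\<dots> < cosh s"
    by (simp add: abs_if sinh_less_cosh_real flip: sinh_minus)
       (metis cosh_minus sinh_less_cosh_real)
  finally show ?thesis by linarith
qed

lemma polar_point_in_upper_half_plane: "polar_point s \<theta> \<in> upper_half_plane"
  using polar_denominator_pos[of s \<theta>] by (simp add: upper_half_plane_def polar_point_def)

lemma hyp_dist_polar_point:
  "hyp_dist (polar_point s \<theta>) (polar_point t \<phi>) =
     arcosh (cosh s * cosh t - sinh s * sinh t * cos (\<theta> - \<phi>))"
proof -
  define D where "D = cosh s - sinh s * cos \<theta>"
  define E where "E = cosh t - sinh t * cos \<phi>"
  have pos: "D > 0" "E > 0" using polar_denominator_pos by (auto simp: D_def E_def)
  have sq: "(sinh r * sin \<psi>)\<^sup>2 + 1 =
      (cosh r - sinh r * cos \<psi>) * (cosh r + sinh r * cos \<psi>)" for r \<psi> :: real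
  proof -
    have "sin \<psi> ^ 2 = 1 - cos \<psi> ^ 2" "cosh r ^ 2 = sinh r ^ 2 + 1"
      by (simp_all add: sin_squared_eq cosh_square_eq)
    then show ?thesis by algebra
  qed
  let ?M = "sinh s * sin \<theta>" and ?N = "sinh t * sin \<phi>"
  have s1: "?M\<^sup>2 + 1 = D * (cosh s + sinh s * cos \<theta>)"
   and s2: "?N\<^sup>2 + 1 = E * (cosh t + sinh t * cos \<phi>)"
    unfolding D_def E_def by (rule sq)+
  have "1 + (cmod (polar_point s \<theta> - polar_point t \<phi>))\<^sup>2 /
             (2 * Im (polar_point s \<theta>) * Im (polar_point t \<phi>)) =
        1 + ((?M / D - ?N / E)\<^sup>2 + (1 / D - 1 / E)\<^sup>2) / (2 / (D * E))"
    by (simp add: cmod_power2 polar_point_def D_def E_def)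
  also have "\<dots> = ((?M\<^sup>2 + 1) * E / D + (?N\<^sup>2 + 1) * D / E) / 2 - ?M * ?N"
    using pos by (simp add: field_simps power2_eq_square)
  also have "\<dots> = ((cosh s + sinh s * cos \<theta>) * E + (cosh t + sinh t * cos \<phi>) * D) / 2 - ?M * ?N"
    unfolding s1 s2 using pos by simp
  also have "\<dots> = cosh s * cosh t - sinh s * sinh t * cos (\<theta> - \<phi>)"
    by (simp add: D_def E_def cos_diff field_simps)
  finally show ?thesis by (simp add: hyp_dist_def)
qed

lemma hyp_dist_polar_ray: "hyp_dist (polar_point s \<theta>) (polar_point t \<theta>) = \<bar>s - t\<bar>"
proof -
  have "hyp_dist (polar_point s \<theta>) (polar_point t \<theta>) = arcosh (cosh \<bar>s - t\<bar>)"
    by (simp add: hyp_dist_polar_point cosh_diff)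
  then show ?thesis by (simp only: arcosh_cosh_real abs_ge_zero)
qed

lemma sinh_div_le_exp:
  fixes s a :: real assumes "0 \<le> s" "s \<le> a" "0 < a"
  shows "sinh s / sinh a \<le> exp (s - a)"
proof -
  have "sinh s * exp a \<le> sinh a * exp s"
  proof -
    have "exp (a - s) \<ge> exp (s - a)" using assms by simp
    then show ?thesis by (simp add: sinh_def algebra_simps flip: exp_add) 
  qed
  then show ?thesis using assms by (simp add: exp_diff field_simps)
qed

lemma gromov_product_le:
  "gromov_product w x y \<le> dist w x" "gromov_product w x y \<le> dist w y"
proof -
  have "dist w x \<le> dist w y + dist x y" "dist w y \<le> dist w x + dist x y"
    by metric+
  then show "gromov_product w x y \<le> dist w x" "gromov_product w x y \<le> dist w y"
    by (simp_all add: gromov_product_def)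
qed

lemma gromov_product_commute: "gromov_product w x y = gromov_product w y x"
  by (simp add: gromov_product_def dist_commute)

text \<open>
  Comparison with the hyperbolic plane.  There the angle \<open>\<theta>\<close> of a triangle with sides \<open>a\<close>, \<open>h\<close> at
  the vertex and opposite side \<open>r\<close> satisfies \<open>(1 - cos \<theta>) sinh a sinh h \<le> exp r\<close>, and the points at
  distance \<open>t\<close> from the vertex are at a distance whose hyperbolic cosine is
  \<open>1 + (1 - cos \<theta>) sinh\<^sup>2 t\<close>.  For \<open>t\<close> up to the Gromov product \<open>(a + h - r) / 2\<close> the exponentials
  cancel and the latter is at most \<open>2\<close>.
\<close>

lemma CAT_minus_one_thin:
  fixes x y z :: "'x::metric_space"
  assumes cat: "CAT_minus_one TYPE('x)"
    and c: "geodesic_segment x y c" and e: "geodesic_segment x z e"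
    and t: "0 \<le> t" "t \<le> gromov_product x y z"
  shows "dist (c t) (e t) \<le> arcosh 2"
proof -
  define a where "a = dist x y"
  define h where "h = dist x z"
  define r where "r = dist y z"
  have tri: "\<bar>a - h\<bar> \<le> r" "r \<le> a + h" "0 \<le> a" "0 \<le> h" "0 \<le> r"
    unfolding a_def h_def r_def by (metric | simp)+
  have ta: "t \<le> a" "t \<le> h" "2 * t \<le> a + h - r"
    using t gromov_product_le[of x y z]
    by (simp_all add: a_def h_def r_def gromov_product_def)
  show ?thesis
  proof (cases "a > 0 \<and> h > 0")
    case False
    then have "t = 0" using t ta by linarith
    then show ?thesis using c e by (simp add: geodesic_segment_def)
  next
    case True
    then have sp: "sinh a > 0" "sinh h > 0" by auto
    define v where "v = (cosh a * cosh h - cosh r) / (sinh a * sinh h)"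
    have "cosh (a - h) \<le> cosh r"
      using tri cosh_real_nonneg_le_iff[of "\<bar>a - h\<bar>" r] by simp
    then have v1: "v \<le> 1" using sp by (simp add: v_def cosh_diff)
    have "cosh r \<le> cosh (a + h)" using tri by (simp add: cosh_real_nonneg_le_iff)
    then have v2: "- 1 \<le> v" using sp by (simp add: v_def cosh_add field_simps)
    define \<theta> where "\<theta> = arccos v"
    have ct: "cos \<theta> = v" using v1 v2 by (simp add: \<theta>_def)
    have eq: "sinh a * sinh h * v = cosh a * cosh h - cosh r" using sp by (simp add: v_def)
    have yz: "hyp_dist (polar_point a 0) (polar_point h \<theta>) = r"
      using tri by (simp add: hyp_dist_polar_point ct eq arcosh_cosh_real)
    have yx: "hyp_dist (polar_point 0 0) (polar_point a 0) = a" 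
      using tri by (simp add: hyp_dist_polar_ray)
    have zx: "hyp_dist (polar_point 0 0) (polar_point s \<theta>) = s" if "s \<ge> 0" for s
      using that by (simp add: hyp_dist_polar_point arcosh_cosh_real)
    have "dist (c t) (e t) \<le> hyp_dist (polar_point t 0) (polar_point t \<theta>)"
    proof -
      have "t \<in> {0..dist x y}" "t \<in> {0..dist x z}" using t ta by (auto simp: a_def h_def)
      then show ?thesis
        using cat[unfolded CAT_minus_one_def, THEN conjunct2, rule_format,
            of t x y t z "polar_point 0 0" "polar_point a 0" "polar_point h \<theta>" "polar_point t 0"
               "polar_point t \<theta>" c e]
          polar_point_in_upper_half_plane c e yz yx zx t ta tri
        by (simp add: hyp_dist_polar_ray a_def h_def r_def)
    qed
    also have "\<dots> = arcosh (1 + (sinh t)\<^sup>2 * (1 - v))"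
      by (simp add: hyp_dist_polar_point ct cosh_square_eq algebra_simps flip: power2_eq_square)
    also have "\<dots> \<le> arcosh 2"
    proof -
      have "1 - v = (cosh r - cosh (a - h)) / (sinh a * sinh h)"
        using sp by (simp add: v_def cosh_diff field_simps)
      also have "\<dots> \<le> exp r / (sinh a * sinh h)"
      proof -
        have "cosh r \<le> exp r" using tri by (simp add: cosh_def)
        then have "cosh r - cosh (a - h) \<le> exp r"
          using cosh_real_nonneg[of "a - h"] by linarith
        then show ?thesis using sp by (intro divide_right_mono) auto
      qed
      finally have "(sinh t)\<^sup>2 * (1 - v) \<le> (sinh t / sinh a) * (sinh t / sinh h) * exp r"
        using mult_left_mono[of "1 - v" "exp r / (sinh a * sinh h)" "(sinh t)\<^sup>2"]
        by (simp add: power2_eq_square)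
      also have "\<dots> \<le> exp (t - a) * exp (t - h) * exp r"
        using t ta True sp by (intro mult_mono sinh_div_le_exp) auto
      also have "\<dots> \<le> 1"
        using ta by (simp flip: exp_add)
      finally have le: "(sinh t)\<^sup>2 * (1 - v) \<le> 1" .
      show ?thesis
        using le v1 arcosh_less_iff_real[of 2 "1 + (sinh t)\<^sup>2 * (1 - v)"]
          mult_nonneg_nonneg[of "(sinh t)\<^sup>2" "1 - v"]
        by (metis add_mono_thms_linordered_semiring(2) diff_ge_0_iff_ge le_add_same_cancel1
            linorder_not_less one_add_one one_le_numeral zero_le_power2)
    qed
    finally show ?thesis .
  qed
qed

lemma geodesic_segment_dist:
  assumes "geodesic_segment x y c" "0 \<le> s" "s \<le> t" "t \<le> dist x y"
  shows "dist (c s) (c t) = t - s" "dist x (c t) = t" "dist (c t) y = dist x y - t"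
proof -
  have *: "dist (c u) (c v) = \<bar>u - v\<bar>" if "u \<in> {0..dist x y}" "v \<in> {0..dist x y}" for u v
    using assms that by (auto simp: geodesic_segment_def geodesic_on_def)
  have "c 0 = x" "c (dist x y) = y" using assms by (auto simp: geodesic_segment_def)
  then show "dist (c s) (c t) = t - s" "dist x (c t) = t" "dist (c t) y = dist x y - t"
    using assms *[of s t] *[of 0 t] *[of t "dist x y"] by auto
qed

text \<open>
  Up to the smaller of two Gromov products all three geodesics issuing from \<open>w\<close> fellow-travel.
\<close>

lemma CAT_minus_one_hyperbolic:
  fixes w x y z :: "'x::metric_space"
  assumes cat: "CAT_minus_one TYPE('x)"
  shows "min (gromov_product w x y) (gromov_product w y z) - arcosh 2 \<le> gromov_product w x z"
proof -
  define t where "t = min (gromov_product w x y) (gromov_product w y z)"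
  have t0: "0 \<le> t" 
    unfolding t_def gromov_product_def
    using dist_triangle3[of x y w] dist_triangle3[of y z w]
    by (simp add: dist_commute) 
  have ex: "\<exists>c. geodesic_segment w v c" for v :: 'x
    using cat by (auto simp: CAT_minus_one_def)
  obtain cx cy cz where c: "geodesic_segment w x cx" "geodesic_segment w y cy"
    "geodesic_segment w z cz" using ex by metis
  have le: "t \<le> dist w x" "t \<le> dist w z"
    using gromov_product_le[of w x y] gromov_product_le[of w y z] by (auto simp: t_def)
  have "dist (cx t) (cy t) \<le> arcosh 2" "dist (cy t) (cz t) \<le> arcosh 2"
    using CAT_minus_one_thin[OF cat] c t0 by (auto simp: t_def)
  then have "dist x z \<le> (dist w x - t) + 2 * arcosh 2 + (dist w z - t)"
    using geodesic_segment_dist(3)[OF c(1) t0 order_refl le(1)]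
      geodesic_segment_dist(3)[OF c(3) t0 order_refl le(2)]
      dist_triangle[of x z "cx t"] dist_triangle[of "cx t" z "cz t"]
      dist_triangle[of "cx t" "cz t" "cy t"]
    by (simp add: dist_commute)
  then show ?thesis unfolding t_def[symmetric] by (simp add: gromov_product_def)
qed

section \<open>Stability of quasi-geodesics\<close>

text \<open>
  Hyperbolicity in the four-point form of Gromov.  Together with the existence of geodesics it is
  what the stability of quasi-geodesics rests on.
\<close>

locale hyperbolic_geodesic =
  fixes space_type :: "'x::metric_space itself" and \<delta> :: real
  assumes delta: "\<delta> \<ge> 0"
    and hyp: "\<And>w x y z :: 'x. min (gromov_product w x y) (gromov_product w y z) - \<delta> \<le> gromov_product w x z"
    and geodesic: "\<And>x y :: 'x. \<exists>c. geodesic_segment x y c"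
begin

text \<open>
  Bisecting a chain of \<open>2\<^sup>k\<close> steps costs one \<open>\<delta>\<close> per level.
\<close>

lemma gromov_product_chain:
  fixes f :: "nat \<Rightarrow> 'x"
  assumes "\<And>l. i \<le> l \<Longrightarrow> l < j \<Longrightarrow> r \<le> gromov_product w (f l) (f (Suc l))"
    and "i < j" "j - i \<le> 2 ^ k"
  shows "r - real k * \<delta> \<le> gromov_product w (f i) (f j)"
  using assms
proof (induction k arbitrary: i j)
  case 0
  then have "j = Suc i" by simp
  then show ?case using 0 by simp
next
  case (Suc k)
  show ?case
  proof (cases "j - i \<le> 2 ^ k")
    case True
    have "r - real k * \<delta> \<le> gromov_product w (f i) (f j)"
      using Suc True by blast
    then show ?thesis using delta by (simp add: algebra_simps)
  next
    case False
    define h where "h = i + 2 ^ k"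
    have h: "i < h" "h < j" "h - i \<le> 2 ^ k" "j - h \<le> 2 ^ k"
      using False Suc.prems by (auto simp: h_def)
    have "r - real k * \<delta> \<le> gromov_product w (f i) (f h)"
      by (rule Suc.IH) (use Suc.prems h in auto)
    moreover have "r - real k * \<delta> \<le> gromov_product w (f h) (f j)"
      by (rule Suc.IH) (use Suc.prems h in auto)
    ultimately show ?thesis using hyp[of w "f i" "f h" "f j"] by (simp add: algebra_simps)
  qed
qed

lemma gromov_product_chain_log:
  fixes f :: "nat \<Rightarrow> 'x"
  assumes step: "\<And>l. l < n \<Longrightarrow> r \<le> gromov_product w (f l) (f (Suc l))"
    and self: "\<And>l. l \<le> n \<Longrightarrow> r \<le> gromov_product w (f l) (f l)"
    and ij: "i \<le> n" "j \<le> n" "\<bar>real i - real j\<bar> \<le> N" and N: "N \<ge> 1"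
  shows "r - (log 2 N + 1) * \<delta> \<le> gromov_product w (f i) (f j)"
proof -
  define k where "k = nat \<lceil>log 2 N\<rceil>"
  have l0: "log 2 N \<ge> 0" using N by simp
  have k: "real k \<le> log 2 N + 1" "log 2 N \<le> real k"
    using l0 unfolding k_def by linarith+
  have "N = 2 powr log 2 N" using N by simp
  also have "\<dots> \<le> 2 powr real k" using k by (intro powr_mono) auto
  also have "\<dots> = 2 ^ k" by (simp add: powr_realpow)
  finally have N2: "N \<le> 2 ^ k" .
  have main: "r - real k * \<delta> \<le> gromov_product w (f a) (f b)"
    if "a < b" "b \<le> n" "\<bar>real a - real b\<bar> \<le> N" for a b
  proof (rule gromov_product_chain)
    have "real (b - a) \<le> real (2 ^ k)" using that N2 by simp
    then show "b - a \<le> 2 ^ k" by (simp only: of_nat_le_iff)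
  qed (use that step in auto)
  have "r - real k * \<delta> \<le> gromov_product w (f i) (f j)"
  proof (cases i j rule: linorder_cases)
    case less
    then show ?thesis using main ij by blast
  next
    case equal
    have "0 \<le> real k * \<delta>" using delta by simp
    then show ?thesis using self ij equal by fastforce
  next
    case greater
    then show ?thesis using main[of j i] ij
      by (subst gromov_product_commute) (auto simp: abs_minus_commute)
  qed
  moreover have "real k * \<delta> \<le> (log 2 N + 1) * \<delta>" using k delta by (intro mult_right_mono)
  ultimately show ?thesis by linarith
qed

definition quasi_geodesic :: "real \<Rightarrow> real \<Rightarrow> real \<Rightarrow> nat \<Rightarrow> (nat \<Rightarrow> 'x) \<Rightarrow> bool" where
  "quasi_geodesic D a C n f \<longleftrightarrow>
     (\<forall>i<n. dist (f i) (f (Suc i)) \<le> D) \<and>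
     (\<forall>i\<le>n. \<forall>j\<le>n. a * \<bar>real i - real j\<bar> - C \<le> dist (f i) (f j))"

text \<open>
  Let \<open>c t\<close> be the point of the geodesic farthest from the path, at distance \<open>E\<close>.  Leave the
  geodesic at distance at most \<open>2 E\<close> on either side of \<open>c t\<close>, each time moving to a nearby point of
  the path.  The part of the path in between has \<open>O(E)\<close> points, and all of this detour stays at
  distance about \<open>E\<close> from \<open>c t\<close>; but a detour around a point of a geodesic needs a number of steps
  exponential in that distance.  So \<open>E\<close> is bounded by the logarithm of a linear function of \<open>E\<close>.
\<close>

lemma farthest_geodesic_point_bound:
  fixes f :: "nat \<Rightarrow> 'x"
  assumes f: "quasi_geodesic D a C n f" and pos: "D \<ge> 0" "a > 0" "C \<ge> 0"
    and c: "geodesic_segment (f 0) (f n) c" and L: "L = dist (f 0) (f n)"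
    and t: "t \<in> {0..L}" and far: "\<And>i. i \<le> n \<Longrightarrow> E \<le> dist (c t) (f i)"
    and near: "\<And>s. s \<in> {0..L} \<Longrightarrow> \<exists>i\<le>n. dist (c s) (f i) \<le> E"
    and E: "E \<ge> 0"
  shows "E \<le> D / 2 + (log 2 ((6 * E + C) / a + 1) + 3) * \<delta>"
proof -
  let ?p = "c t"
  have cs: "dist (c u) (c v) = \<bar>u - v\<bar>" if "u \<in> {0..L}" "v \<in> {0..L}" for u v
    using c that by (auto simp: geodesic_segment_def geodesic_on_def L)
  have c0: "c 0 = f 0" "c L = f n" using c by (auto simp: geodesic_segment_def L)
  have L0: "L \<ge> 0" by (simp add: L)
  have "\<exists>s i. s \<in> {0..L} \<and> s \<le> t \<and> t - s \<le> 2 * E \<and> i \<le> n \<and> dist (c s) (f i) \<le> E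
         \<and> E \<le> gromov_product ?p (c s) (f i)"
  proof (cases "t \<ge> 2 * E")
    case True
    obtain i where i: "i \<le> n" "dist (c (t - 2 * E)) (f i) \<le> E"
      using near[of "t - 2 * E"] True t E by auto
    have "dist ?p (c (t - 2 * E)) = 2 * E" using cs[of t "t - 2 * E"] True t E by auto
    then have "E \<le> gromov_product ?p (c (t - 2 * E)) (f i)"
      using far[OF i(1)] i by (simp add: gromov_product_def)
    then show ?thesis using i True t E by (intro exI[of _ "t - 2 * E"] exI[of _ i]) auto
  next
    case False
    then show ?thesis using far[of 0] t E L0 c0
      by (intro exI[of _ 0] exI[of _ 0]) (auto simp: gromov_product_def)
  qed
  then obtain s i where s: "s \<in> {0..L}" "s \<le> t" "t - s \<le> 2 * E" "i \<le> n" "dist (c s) (f i) \<le> E"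
    "E \<le> gromov_product ?p (c s) (f i)" by blast
  have "\<exists>s i. s \<in> {0..L} \<and> t \<le> s \<and> s - t \<le> 2 * E \<and> i \<le> n \<and> dist (c s) (f i) \<le> E
         \<and> E \<le> gromov_product ?p (c s) (f i)"
  proof (cases "t + 2 * E \<le> L")
    case True
    obtain i where i: "i \<le> n" "dist (c (t + 2 * E)) (f i) \<le> E"
      using near[of "t + 2 * E"] True t E by auto
    have "dist ?p (c (t + 2 * E)) = 2 * E" using cs[of t "t + 2 * E"] True t E by auto
    then have "E \<le> gromov_product ?p (c (t + 2 * E)) (f i)"
      using far[OF i(1)] i by (simp add: gromov_product_def)
    then show ?thesis using i True t E by (intro exI[of _ "t + 2 * E"] exI[of _ i]) auto
  next
    case False
    then show ?thesis using far[of n] t E L0 c0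
      by (intro exI[of _ L] exI[of _ n]) (auto simp: gromov_product_def)
  qed
  then obtain u j where u: "u \<in> {0..L}" "t \<le> u" "u - t \<le> 2 * E" "j \<le> n" "dist (c u) (f j) \<le> E"
    "E \<le> gromov_product ?p (c u) (f j)" by blast
  have "dist (f i) (f j) \<le> dist (c s) (f i) + dist (c s) (c u) + dist (c u) (f j)" by metric
  also have "\<dots> \<le> 6 * E" using cs[of s u] s u by auto
  finally have "a * \<bar>real i - real j\<bar> - C \<le> 6 * E"
    using f s(4) u(4) unfolding quasi_geodesic_def by fastforce
  then have ij: "\<bar>real i - real j\<bar> \<le> (6 * E + C) / a + 1"
    using pos by (simp add: field_simps)
  define r where "r = E - D / 2"
  have rE: "r \<le> E" using pos by (simp add: r_def)
  have "r - (log 2 ((6 * E + C) / a + 1) + 1) * \<delta> \<le> gromov_product ?p (f i) (f j)"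
  proof (rule gromov_product_chain_log[OF _ _ s(4) u(4) ij])
    show "r \<le> gromov_product ?p (f l) (f (Suc l))" if "l < n" for l
    proof -
      have "dist (f l) (f (Suc l)) \<le> D" using f that by (auto simp: quasi_geodesic_def)
      then show ?thesis using far[of l] far[of "Suc l"] that
        by (simp add: gromov_product_def r_def)
    qed
    show "r \<le> gromov_product ?p (f l) (f l)" if "l \<le> n" for l
      using far[of l] that rE by (simp add: gromov_product_def)
    show "1 \<le> (6 * E + C) / a + 1" using pos E by simp
  qed
  moreover have "(6 * E + C) / a \<ge> 0" using pos E by simp
  then have "0 \<le> log 2 ((6 * E + C) / a + 1)" by simp
  then have "0 \<le> (log 2 ((6 * E + C) / a + 1) + 1) * \<delta>" using delta by simp
  ultimately have "r - (log 2 ((6 * E + C) / a + 1) + 2) * \<delta> \<le> gromov_product ?p (c s) (f j)"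
    using hyp[of ?p "c s" "f i" "f j"] s rE by (simp add: algebra_simps)
  then have "r - (log 2 ((6 * E + C) / a + 1) + 3) * \<delta> \<le> gromov_product ?p (c s) (c u)"
    using hyp[of ?p "c s" "f j" "c u"] u rE \<open>0 \<le> (log 2 ((6 * E + C) / a + 1) + 1) * \<delta>\<close> delta
    by (simp add: algebra_simps gromov_product_commute[of ?p "c u"])
  \<comment> \<open>the point around which the detour is made lies on the geodesic between its ends\<close>
  moreover have "gromov_product ?p (c s) (c u) = 0"
    using cs[of t s] cs[of t u] cs[of s u] s u t by (simp add: gromov_product_def)
  ultimately show ?thesis by (simp add: r_def)
qed

text \<open>
  The farthest point exists because the geodesic is compact, and a number bounded by a logarithmic
  function of itself is bounded.
\<close>

lemma geodesic_near_quasi_geodesic: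
  assumes pos: "D \<ge> 0" "a > 0" "C \<ge> 0"
  shows "\<exists>R\<ge>0. \<forall>n f c t. quasi_geodesic D a C n f \<and> geodesic_segment (f 0) (f n) c \<and>
            t \<in> {0..dist (f 0) (f n)} \<longrightarrow> (\<exists>i\<le>n. dist (c t) (f i) \<le> R)"
proof -
  have "eventually (\<lambda>E. E > D / 2 + (log 2 ((6 * E + C) / a + 1) + 3) * \<delta>) at_top"
  proof -
    have "((\<lambda>E. (D / 2 + (log 2 ((6 * E + C) / a + 1) + 3) * \<delta>) / E) \<longlongrightarrow> 0) at_top"
      using pos by real_asymp
    then have "eventually (\<lambda>E. (D / 2 + (log 2 ((6 * E + C) / a + 1) + 3) * \<delta>) / E < 1) at_top"
      by (rule order_tendstoD) simp
    with eventually_gt_at_top[of 0] show ?thesis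
      by eventually_elim (simp add: field_simps)
  qed
  then obtain R0 where R0: "\<And>E. E \<ge> R0 \<Longrightarrow> E > D / 2 + (log 2 ((6 * E + C) / a + 1) + 3) * \<delta>"
    by (auto simp: eventually_at_top_linorder)
  show ?thesis
  proof (intro exI[of _ "max R0 0"] conjI allI impI)
    fix n and f :: "nat \<Rightarrow> 'x" and c t
    assume *: "quasi_geodesic D a C n f \<and> geodesic_segment (f 0) (f n) c \<and>
            t \<in> {0..dist (f 0) (f n)}"
    define L where "L = dist (f 0) (f n)"
    define g where "g s = infdist (c s) (f ` {..n})" for s
    have cs: "dist (c u) (c v) = \<bar>u - v\<bar>" if "u \<in> {0..L}" "v \<in> {0..L}" for u v
      using * that by (auto simp: geodesic_segment_def geodesic_on_def L_def)
    have ex: "\<exists>i\<le>n. g s = dist (c s) (f i)" for s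
    proof -
      have "\<exists>x\<in>f ` {..n}. infdist (c s) (f ` {..n}) = dist (c s) x"
      proof -
        have "compact (f ` {..n})" by (intro finite_imp_compact) auto
        then obtain y where "y \<in> f ` {..n}" "\<forall>z\<in>f ` {..n}. dist (c s) y \<le> dist (c s) z"
          using continuous_attains_inf[of "f ` {..n}" "dist (c s)"]
          by (fastforce intro: continuous_intros)
        then show ?thesis
          by (intro bexI[of _ y] antisym infdist_le) (auto simp: infdist_def intro!: cINF_greatest)
      qed
      then show ?thesis by (auto simp: g_def)
    qed
    have le: "g s \<le> dist (c s) (f i)" if "i \<le> n" for s i
      unfolding g_def by (rule infdist_le) (use that in auto)
    have "continuous_on {0..L} c"
      unfolding continuous_on_iff using cs by (metis abs_minus_commute dist_real_def dist_commute)
    then have "continuous_on {0..L} g"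
      unfolding g_def by (intro continuous_intros)
    then obtain t0 where t0: "t0 \<in> {0..L}" "\<And>s. s \<in> {0..L} \<Longrightarrow> g s \<le> g t0"
      using continuous_attains_sup[of "{0..L}" g] by (auto simp: L_def)
    have "g t0 \<le> D / 2 + (log 2 ((6 * g t0 + C) / a + 1) + 3) * \<delta>"
    proof (rule farthest_geodesic_point_bound[OF _ pos _ L_def t0(1)])
      show "\<exists>i\<le>n. dist (c s) (f i) \<le> g t0" if "s \<in> {0..L}" for s
        using ex[of s] t0(2)[OF that] by metis
    qed (use * le in \<open>auto simp: g_def infdist_nonneg\<close>)
    then have "g t0 < R0" using R0 by (meson not_le)
    then have "g t \<le> max R0 0" using t0(2)[of t] * by (auto simp: L_def)
    then show "\<exists>i\<le>n. dist (c t) (f i) \<le> max R0 0" using ex[of t] by metis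
  qed simp
qed

lemma quasi_geodesic_dist_le:
  assumes "quasi_geodesic D a C n f" "i \<le> j" "j \<le> n"
  shows "dist (f i) (f j) \<le> D * real (j - i)"
  using assms(2,3)
proof (induction j rule: dec_induct)
  case (step j)
  have "dist (f i) (f (Suc j)) \<le> dist (f i) (f j) + dist (f j) (f (Suc j))" by metric
  also have "\<dots> \<le> D * real (j - i) + D"
    using step assms(1) by (intro add_mono) (auto simp: quasi_geodesic_def)
  finally show ?case using step by (simp add: algebra_simps of_nat_diff)
qed simp

text \<open>
  The points of the geodesic that are close to the part of the path before \<open>f m\<close>, and those that are
  close to the part after \<open>f m\<close>, form two closed sets that cover it.  By connectedness some point is
  close to both parts.  A quasi-geodesic cannot return after a long time, so this point is also close
  to \<open>f m\<close> itself.
\<close>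

theorem quasi_geodesic_gromov_product_bounded:
  assumes pos: "D \<ge> 0" "a > 0" "C \<ge> 0"
  shows "\<exists>B. \<forall>n f m. quasi_geodesic D a C n f \<and> m \<le> n \<longrightarrow> gromov_product (f m) (f 0) (f n) \<le> B"
proof -
  obtain R where R0: "R \<ge> 0" and R: "\<And>n f c t. quasi_geodesic D a C n f \<Longrightarrow> geodesic_segment (f 0) (f n) c \<Longrightarrow>
            t \<in> {0..dist (f 0) (f n)} \<Longrightarrow> \<exists>i\<le>n. dist (c t) (f i) \<le> R"
    using geodesic_near_quasi_geodesic[OF pos] by blast
  show ?thesis
  proof (intro exI[of _ "R + D * ((2 * R + C) / a)"] allI impI; elim conjE)
    fix n f m assume f: "quasi_geodesic D a C n f" and m: "m \<le> n"
    obtain c where c: "geodesic_segment (f 0) (f n) c" using geodesic by blast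
    define L where "L = dist (f 0) (f n)"
    have cs: "dist (c u) (c v) = \<bar>u - v\<bar>" if "u \<in> {0..L}" "v \<in> {0..L}" for u v
      using c that by (auto simp: geodesic_segment_def geodesic_on_def L_def)
    have c0: "c 0 = f 0" "c L = f n" using c by (auto simp: geodesic_segment_def L_def)
    have cont: "continuous_on {0..L} c"
      unfolding continuous_on_iff using cs by (metis abs_minus_commute dist_real_def dist_commute)
    define S where "S I = (\<Union>i\<in>I. {t\<in>{0..L}. dist (c t) (f i) \<le> R})" for I
    have cl: "closed (S I)" if "finite I" for I
      unfolding S_def
      by (intro closed_UN that ballI continuous_on_closed_Collect_le continuous_intros cont)
    have cover: "{0..L} \<subseteq> S {..m} \<union> S {m..n}"
    proof
      fix t assume t: "t \<in> {0..L}"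
      then obtain i where "i \<le> n" "dist (c t) (f i) \<le> R" using R[OF f c] by (auto simp: L_def)
      then show "t \<in> S {..m} \<union> S {m..n}" using t by (cases "i \<le> m") (auto simp: S_def)
    qed
    have "0 \<in> S {..m} \<inter> {0..L}"
      using R0 c0 by (auto simp: S_def L_def intro!: bexI[of _ 0])
    moreover have "L \<in> S {m..n} \<inter> {0..L}"
      using R0 c0 m by (auto simp: S_def L_def intro!: bexI[of _ n])
    moreover have "\<not> (S {..m} \<inter> {0..L} \<noteq> {} \<and> S {m..n} \<inter> {0..L} \<noteq> {} \<and> S {..m} \<inter> S {m..n} \<inter> {0..L} = {})"
      using connected_closed[of "{0..L}"] cl[of "{..m}"] cl[of "{m..n}"] cover connected_Icc[of 0 L]
      by auto
    ultimately obtain t where "t \<in> S {..m}" "t \<in> S {m..n}" by blast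
    then obtain i j where ij: "i \<le> m" "m \<le> j" "j \<le> n" "dist (c t) (f i) \<le> R" "dist (c t) (f j) \<le> R"
      and t: "t \<in> {0..L}"
      by (auto simp: S_def)
    have "a * \<bar>real i - real j\<bar> - C \<le> dist (f i) (f j)"
      using f ij unfolding quasi_geodesic_def by (meson le_trans)
    also have "\<dots> \<le> 2 * R" using ij(4,5) by metric
    finally have "real j - real i \<le> (2 * R + C) / a"
      using ij pos by (simp add: field_simps)
    then have mi: "real (m - i) \<le> (2 * R + C) / a" using ij by (simp add: of_nat_diff)
    have "dist (f i) (f m) \<le> D * real (m - i)"
      using quasi_geodesic_dist_le[OF f] ij by simp
    also have "\<dots> \<le> D * ((2 * R + C) / a)" using mi pos by (intro mult_left_mono)
    finally have near: "dist (f m) (c t) \<le> R + D * ((2 * R + C) / a)"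
      using ij(4) dist_triangle[of "f m" "c t" "f i"] by (simp add: dist_commute)
    have "dist (f 0) (f n) = dist (f 0) (c t) + dist (c t) (f n)"
      using cs[of 0 t] cs[of t L] t c0 by (auto simp: L_def)
    then have "gromov_product (f m) (f 0) (f n) \<le> dist (f m) (c t)"
      unfolding gromov_product_def
      using dist_triangle[of "f m" "f 0" "c t"] dist_triangle[of "f m" "f n" "c t"]
      by (simp add: dist_commute)
    then show "gromov_product (f m) (f 0) (f n) \<le> R + D * ((2 * R + C) / a)"
      using near by linarith
  qed
qed

end

lemma CAT_minus_one_hyperbolic_geodesic:
  assumes "CAT_minus_one TYPE('x::metric_space)"
  shows "hyperbolic_geodesic TYPE('x) (arcosh 2)"
proof
  show "(0::real) \<le> arcosh 2" by simp
qed (use assms CAT_minus_one_hyperbolic in \<open>auto simp: CAT_minus_one_def\<close>)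

section \<open>Linear growth of orbits of a convex co-compact action\<close>

lemma (in group) mult_inv_cancel:
  assumes "x \<in> carrier G" "y \<in> carrier G"
  shows "x \<otimes> (inv x \<otimes> y) = y" "inv x \<otimes> (x \<otimes> y) = y"
  using assms by (simp_all flip: m_assoc)

lemma compact_range_with_limit:
  fixes f :: "nat \<Rightarrow> 'x::metric_space"
  assumes "f \<longlonglongrightarrow> l"
  shows "compact (insert l (range f))"
  using compactin_sequence_with_limit[of euclidean f l "range f"] assms by simp

locale isometric_group_action = group G for G (structure) +
  fixes act :: "'a \<Rightarrow> 'x::metric_space \<Rightarrow> 'x"
  assumes isometric: "isometric_action G act"
begin

lemma action: "group_action G UNIV act"
  using isometric by (simp add: isometric_action_def)

lemma act_mult: "g \<in> carrier G \<Longrightarrow> h \<in> carrier G \<Longrightarrow> act (g \<otimes> h) x = act g (act h x)"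
  using group_action.composition_rule[OF action] by auto

lemma act_one [simp]: "act \<one> x = x"
  using group_action.id_eq_one[OF action] by (metis UNIV_I restrict_apply')

lemma act_inv_act [simp]: "g \<in> carrier G \<Longrightarrow> act (inv g) (act g x) = x"
  by (metis act_mult act_one inv_closed l_inv)

lemma act_act_inv [simp]: "g \<in> carrier G \<Longrightarrow> act g (act (inv g) x) = x"
  by (metis act_mult act_one inv_closed r_inv)

lemma dist_act [simp]: "g \<in> carrier G \<Longrightarrow> dist (act g x) (act g y) = dist x y"
  using isometric by (simp add: isometric_action_def)

lemma dist_act_left: "g \<in> carrier G \<Longrightarrow> dist (act g x) y = dist x (act (inv g) y)"
  by (metis act_act_inv dist_act)

text \<open>
  The action of a group element on the space together with its boundary.
\<close>

definition act_compactification :: "'a \<Rightarrow> 'x + (real \<Rightarrow> 'x) set \<Rightarrow> 'x + (real \<Rightarrow> 'x) set" where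
  "act_compactification g = map_sum (act g) ((`) ((\<circ>) (act g)))"

lemma geodesic_on_act: "g \<in> carrier G \<Longrightarrow> geodesic_on I (act g \<circ> c) \<longleftrightarrow> geodesic_on I c"
  by (simp add: geodesic_on_def)

lemma act_ideal_point:
  assumes g: "g \<in> carrier G"
  shows "(\<circ>) (act g) ` ideal_point c = ideal_point (act g \<circ> c)"
proof (intro equalityI subsetI)
  fix c' assume "c' \<in> (\<circ>) (act g) ` ideal_point c"
  then show "c' \<in> ideal_point (act g \<circ> c)"
    using g by (auto simp: ideal_point_def geodesic_ray_def geodesic_on_act asymptotic_def)
next
  fix c' assume c': "c' \<in> ideal_point (act g \<circ> c)"
  have "c' = act g \<circ> (act (inv g) \<circ> c')" using g by (auto simp: fun_eq_iff)
  moreover have "act (inv g) \<circ> c' \<in> ideal_point c"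
    using c' g by (auto simp: ideal_point_def geodesic_ray_def geodesic_on_act asymptotic_def dist_act_left)
  ultimately show "c' \<in> (\<circ>) (act g) ` ideal_point c" by blast
qed

text \<open>
  The reason why hulls of invariant sets are invariant.
\<close>

lemma geod_convex_vimage:
  assumes g: "g \<in> carrier G" and S: "geod_convex S"
  shows "geod_convex (act_compactification g -` S)"
proof -
  note [simp] = act_compactification_def
  have 1: "\<And>x y c s. Inl x \<in> S \<Longrightarrow> Inl y \<in> S \<Longrightarrow> geodesic_segment x y c \<Longrightarrow> s \<in> {0..dist x y} \<Longrightarrow> Inl (c s) \<in> S"
   and 2: "\<And>c s. geodesic_ray c \<Longrightarrow> Inl (c 0) \<in> S \<Longrightarrow> Inr (ideal_point c) \<in> S \<Longrightarrow> s \<ge> 0 \<Longrightarrow> Inl (c s) \<in> S"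
   and 3: "\<And>c s. geodesic_line c \<Longrightarrow> Inr (ideal_point c) \<in> S \<Longrightarrow> Inr (ideal_point (\<lambda>t. c (- t))) \<in> S \<Longrightarrow> Inl (c s) \<in> S"
    using S unfolding geod_convex_def by blast+
  show ?thesis
    unfolding geod_convex_def
  proof (intro conjI allI impI; elim conjE)
    fix x y c
    assume *: "Inl x \<in> act_compactification g -` S" "Inl y \<in> act_compactification g -` S"
      "geodesic_segment x y c"
    have "geodesic_segment (act g x) (act g y) (act g \<circ> c)"
      using * g by (simp add: geodesic_segment_def geodesic_on_act)
    then show "Inl ` c ` {0..dist x y} \<subseteq> act_compactification g -` S"
      using 1[of "act g x" "act g y" "act g \<circ> c"] * g by auto
  next
    fix c
    assume *: "geodesic_ray c" "Inl (c 0) \<in> act_compactification g -` S"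
      "Inr (ideal_point c) \<in> act_compactification g -` S"
    have "geodesic_ray (act g \<circ> c)" using * g by (simp add: geodesic_ray_def geodesic_on_act)
    then show "Inl ` c ` {0..} \<subseteq> act_compactification g -` S"
      using 2[of "act g \<circ> c"] * g by (auto simp: act_ideal_point)
  next
    fix c
    assume *: "geodesic_line c" "Inr (ideal_point c) \<in> act_compactification g -` S"
      "Inr (ideal_point (\<lambda>t. c (- t))) \<in> act_compactification g -` S"
    have "geodesic_line (act g \<circ> c)" using * g by (simp add: geodesic_line_def geodesic_on_act)
    moreover have "Inr (ideal_point (act g \<circ> c)) \<in> S"
      using * by (simp flip: act_ideal_point[OF g])
    moreover have "(\<lambda>t. (act g \<circ> c) (- t)) = act g \<circ> (\<lambda>t. c (- t))" by (simp add: fun_eq_iff)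
    then have "Inr (ideal_point (\<lambda>t. (act g \<circ> c) (- t))) \<in> S"
      using * by (simp flip: act_ideal_point[OF g])
    ultimately show "Inl ` range c \<subseteq> act_compactification g -` S"
      using 3[of "act g \<circ> c"] by auto
  qed
qed

text \<open>
  Moving all points by \<open>g\<close> changes Gromov products based at \<open>b\<close> by at most \<open>dist b (act g b)\<close>.
\<close>

lemma limit_set_invariant:
  assumes g: "g \<in> carrier G" and \<xi>: "\<xi> \<in> limit_set G act b"
  shows "(\<circ>) (act g) ` \<xi> \<in> limit_set G act b"
proof -
  obtain c h where c: "\<xi> = ideal_point c" "geodesic_ray c" and h: "range h \<subseteq> carrier G"
    and lim: "tends_to_ideal b (\<lambda>n. act (h n) b) c"
    using \<xi> by (auto simp: limit_set_def)
  have hc: "h n \<in> carrier G" for n using h by auto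
  have "tends_to_ideal b (\<lambda>n. act (g \<otimes> h n) b) (act g \<circ> c)"
    unfolding tends_to_ideal_def filterlim_at_top
  proof
    fix Z
    have "eventually (\<lambda>(n, t). Z + dist b (act g b) \<le> gromov_product b (act (h n) b) (c t))
            (sequentially \<times>\<^sub>F at_top)"
      using lim[unfolded tends_to_ideal_def filterlim_at_top, rule_format, of "Z + dist b (act g b)"]
      by (simp add: case_prod_unfold)
    then show "eventually (\<lambda>p. Z \<le> (case p of (n, t) \<Rightarrow>
        gromov_product b (act (g \<otimes> h n) b) ((act g \<circ> c) t))) (sequentially \<times>\<^sub>F at_top)"
    proof (rule eventually_mono, clarsimp)
      fix n t assume le: "Z + dist b (act g b) \<le> gromov_product b (act (h n) b) (c t)"
      have "dist b x \<le> dist b (act g b) + dist b (act g x)" for x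
        using dist_triangle[of "act g b" "act g x" b] g by (simp add: dist_commute)
      from this[of "act (h n) b"] this[of "c t"]
      show "Z \<le> gromov_product b (act (g \<otimes> h n) b) (act g (c t))"
        using le g hc by (simp add: gromov_product_def act_mult)
    qed
  qed
  moreover have "geodesic_ray (act g \<circ> c)"
    using c g by (simp add: geodesic_ray_def geodesic_on_act)
  moreover have "range (\<lambda>n. g \<otimes> h n) \<subseteq> carrier G" using g hc by auto
  ultimately show ?thesis
    unfolding limit_set_def c act_ideal_point[OF g]
    by (intro CollectI exI[of _ "act g \<circ> c"] conjI refl exI[of _ "\<lambda>n. g \<otimes> h n"])
qed

lemma convex_core_invariant:
  assumes g: "g \<in> carrier G" and x: "x \<in> convex_core G act b"
  shows "act g x \<in> convex_core G act b"
  unfolding convex_core_def hull_def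
proof (intro CollectI InterI)
  fix t assume t: "t \<in> {t. geod_convex t \<and> Inr ` limit_set G act b \<subseteq> t}"
  have "Inr \<xi> \<in> t" if "\<xi> \<in> limit_set G act b" for \<xi> using t that by blast
  then have "Inr ` limit_set G act b \<subseteq> act_compactification g -` t"
    using limit_set_invariant[OF g] by (auto simp: act_compactification_def)
  then have "Inl x \<in> act_compactification g -` t"
    using x t geod_convex_vimage[OF g] unfolding convex_core_def hull_def by blast
  then show "Inl (act g x) \<in> t" by (simp add: act_compactification_def)
qed

lemma convex_core_convex:
  assumes "x \<in> convex_core G act b" "y \<in> convex_core G act b" "geodesic_segment x y c"
    and "s \<in> {0..dist x y}"
  shows "c s \<in> convex_core G act b"
  unfolding convex_core_def hull_def
proof (intro CollectI InterI)
  fix t assume t: "t \<in> {t. geod_convex t \<and> Inr ` limit_set G act b \<subseteq> t}"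
  then have "Inl x \<in> t" "Inl y \<in> t" using assms by (auto simp: convex_core_def hull_def)
  then show "Inl (c s) \<in> t" using t assms unfolding geod_convex_def by blast
qed

text \<open>
  In a metric space proper discontinuity, which speaks of compact sets, controls small balls as well:
  from infinitely many returns to arbitrarily small balls around \<open>x\<close> one builds two sequences
  converging to \<open>x\<close>; together with \<open>x\<close> they form a compact set with infinitely many returns.
\<close>

lemma locally_finite:
  assumes pd: "properly_discontinuous G act"
  shows "\<exists>r>0. finite {g \<in> carrier G. act g ` ball x r \<inter> ball x r \<noteq> {}}"
proof (rule ccontr)
  assume no: "\<not> ?thesis"
  define F where "F n = {g \<in> carrier G. act g ` ball x (1 / Suc n) \<inter> ball x (1 / Suc n) \<noteq> {}}" for n
  have inf: "infinite (F n)" for n using no unfolding F_def by (auto dest!: spec[of _ "1 / Suc n"])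
  have "\<exists>g. \<forall>n. g n \<in> F n \<and> g n \<notin> g ` {..<n}"
  proof (rule dependent_wellorder_choice)
    fix n and f :: "nat \<Rightarrow> 'a"
    have "infinite (F n - f ` {..<n})" using inf[of n] by (simp add: Diff_infinite_finite)
    then have "F n - f ` {..<n} \<noteq> {}" by (rule infinite_imp_nonempty)
    then show "\<exists>r. r \<in> F n \<and> r \<notin> f ` {..<n}" by blast
  qed auto
  then obtain g where g: "\<And>n. g n \<in> F n" "\<And>n. g n \<notin> g ` {..<n}" by blast
  have "\<exists>y. y \<in> ball x (1 / Suc n) \<and> act (g n) y \<in> ball x (1 / Suc n)" for n
    using g(1)[of n] by (auto simp: F_def)
  then obtain y where y: "\<And>n. y n \<in> ball x (1 / Suc n)" "\<And>n. act (g n) (y n) \<in> ball x (1 / Suc n)"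
    by metis
  have conv: "z \<longlonglongrightarrow> x" if "\<And>n. z n \<in> ball x (1 / Suc n)" for z
    unfolding tendsto_dist_iff[of z]
  proof (rule tendsto_sandwich[OF _ _ tendsto_const LIMSEQ_inverse_real_of_nat])
    show "eventually (\<lambda>n. dist (z n) x \<le> inverse (real (Suc n))) sequentially"
      using that by (intro always_eventually allI)
        (force simp: dist_commute inverse_eq_divide intro: less_imp_le)
  qed auto
  define K where "K = insert x (range y) \<union> insert x (range (\<lambda>n. act (g n) (y n)))"
  have "compact K"
    unfolding K_def using conv[OF y(1)] conv[OF y(2)]
    by (intro compact_Un compact_range_with_limit)
  then have "finite {g \<in> carrier G. act g ` K \<inter> K \<noteq> {}}"
    using pd by (simp add: properly_discontinuous_def)
  moreover have "range g \<subseteq> {g \<in> carrier G. act g ` K \<inter> K \<noteq> {}}"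
  proof
    fix h assume "h \<in> range g"
    then obtain n where n: "h = g n" by blast
    have "act (g n) (y n) \<in> act (g n) ` K \<inter> K" by (auto simp: K_def)
    then show "h \<in> {g \<in> carrier G. act g ` K \<inter> K \<noteq> {}}" using g(1)[of n] n by (auto simp: F_def)
  qed
  moreover have "inj g"
  proof (rule linorder_injI)
    fix m n :: nat assume "m < n" then show "g m \<noteq> g n" using g(2)[of n] by (metis image_eqI lessThan_iff)
  qed
  ultimately show False using finite_subset finite_imageD infinite_UNIV_nat by blast
qed

text \<open>
  The orbits that meet a given ball around a point of \<open>C\<close> form an open subset of the orbit space.
\<close>

lemma finite_cover:
  assumes cpt: "compact_space (orbit_space G act C)" and r: "\<And>x. r x > (0::real)"
  shows "\<exists>X\<subseteq>C. finite X \<and> (\<forall>y\<in>C. \<exists>x\<in>X. \<exists>g\<in>carrier G. dist (act g x) y < r x)"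
proof -
  define V where "V x = {y \<in> C. \<exists>g\<in>carrier G. dist (act g x) y < r x}" for x
  define U where "U x = orbit G act ` V x" for x
  have orbit_mem: "y \<in> V x" if y: "y \<in> C" "orbit G act y \<in> U x" for x y
  proof -
    obtain z where z: "z \<in> V x" "orbit G act y = orbit G act z" using y by (auto simp: U_def)
    have "z \<in> orbit G act z" unfolding orbit_def by (auto intro: exI[of _ \<one>])
    then obtain h where h: "h \<in> carrier G" "z = act h y" using z by (auto simp: orbit_def)
    obtain g where g: "g \<in> carrier G" "dist (act g x) z < r x" using z by (auto simp: V_def)
    have "dist (act (inv h \<otimes> g) x) y < r x"
      using g h by (simp add: act_mult dist_act_left)
    then show ?thesis using g h y by (auto simp: V_def)
  qed
  have "openin (orbit_space G act C) (U x)" for x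
  proof -
    have "{y \<in> C. orbit G act y \<in> U x} = C \<inter> (\<Union>g\<in>carrier G. ball (act g x) (r x))"
    proof -
      have "{y \<in> C. orbit G act y \<in> U x} = V x"
        using orbit_mem by (auto simp: U_def) (simp add: V_def)
      then show ?thesis by (auto simp: V_def)
    qed
    moreover have "openin (top_of_set C) (C \<inter> (\<Union>g\<in>carrier G. ball (act g x) (r x)))"
      by (intro openin_open_Int open_UN ballI open_ball)
    moreover have "U x \<subseteq> orbit G act ` C" unfolding U_def V_def by blast
    ultimately show ?thesis unfolding openin_orbit_space by (simp only: simp_thms)
  qed
  moreover have "topspace (orbit_space G act C) \<subseteq> (\<Union>x\<in>C. U x)"
  proof
    fix u assume "u \<in> topspace (orbit_space G act C)"
    then obtain y where y: "y \<in> C" "u = orbit G act y"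
      using openin_topspace[of "orbit_space G act C"] unfolding openin_orbit_space by blast
    then have "y \<in> V y" using r[of y] by (auto simp: V_def intro!: bexI[of _ \<one>])
    then show "u \<in> (\<Union>x\<in>C. U x)" using y by (auto simp: U_def)
  qed
  ultimately have "(\<forall>W\<in>U ` C. openin (orbit_space G act C) W) \<and>
      topspace (orbit_space G act C) \<subseteq> \<Union>(U ` C)" by simp
  from cpt[unfolded compact_space_alt, THEN spec, THEN mp, OF this]
  obtain F where F: "finite F" "F \<subseteq> U ` C" "topspace (orbit_space G act C) \<subseteq> \<Union>F"
    by (elim exE conjE)
  obtain X where X: "X \<subseteq> C" "finite X" "F = U ` X"
    using finite_subset_image[OF F(1,2)] by blast
  have "openin (orbit_space G act C) (orbit G act ` C)"
    unfolding openin_orbit_space by (auto simp: openin_open intro!: exI[of _ UNIV])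
  then have "orbit G act ` C \<subseteq> topspace (orbit_space G act C)" by (rule openin_subset)
  have "\<forall>y\<in>C. \<exists>x\<in>X. y \<in> V x"
  proof
    fix y assume y: "y \<in> C"
    then have "orbit G act y \<in> \<Union>F"
      using \<open>orbit G act ` C \<subseteq> topspace (orbit_space G act C)\<close> F(3) by (meson image_eqI subsetD)
    then obtain x where "x \<in> X" "orbit G act y \<in> U x" unfolding X(3) by blast
    then show "\<exists>x\<in>X. y \<in> V x" using orbit_mem[OF y] by blast
  qed
  then show ?thesis using X by (intro exI[of _ X]) (auto simp: V_def)
qed

text \<open>
  Two translates of \<open>y\<close> in the ball around \<open>x\<close> differ by an element that returns the ball to itself.
\<close>

lemma finite_close_translates_of_source:
  assumes fin: "finite {g \<in> carrier G. act g ` ball x r \<inter> ball x r \<noteq> {}}"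
  shows "finite {g \<in> carrier G. dist x (act g y) < r}"
proof (cases "{g \<in> carrier G. dist x (act g y) < r} = {}")
  case False
  then obtain h where h: "h \<in> carrier G" "dist x (act h y) < r" by blast
  have "{g \<in> carrier G. dist x (act g y) < r} \<subseteq>
        (\<lambda>g. g \<otimes> h) ` {g \<in> carrier G. act g ` ball x r \<inter> ball x r \<noteq> {}}"
  proof
    fix g assume g: "g \<in> {g \<in> carrier G. dist x (act g y) < r}"
    then have "act (g \<otimes> inv h) (act h y) \<in> ball x r"
      using h by (simp add: act_mult)
    then have "g \<otimes> inv h \<in> {g \<in> carrier G. act g ` ball x r \<inter> ball x r \<noteq> {}}"
      using h g by (auto simp: disjoint_iff intro!: exI[of _ "act h y"])
    moreover have "g = (g \<otimes> inv h) \<otimes> h" using g h by (simp add: m_assoc)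
    ultimately show "g \<in> (\<lambda>g. g \<otimes> h) ` {g \<in> carrier G. act g ` ball x r \<inter> ball x r \<noteq> {}}"
      by blast
  qed
  then show ?thesis using fin finite_subset by blast
next
  case True
  then show ?thesis by (simp only: finite.emptyI)
qed

lemma finite_close_translates_of_target:
  assumes fin: "finite {g \<in> carrier G. act g ` ball y r \<inter> ball y r \<noteq> {}}"
  shows "finite {g \<in> carrier G. dist x (act g y) < r}"
proof -
  have "{g \<in> carrier G. dist x (act g y) < r} \<subseteq> (\<lambda>g. inv g) ` {g \<in> carrier G. dist y (act g x) < r}"
  proof
    fix g assume "g \<in> {g \<in> carrier G. dist x (act g y) < r}"
    then have "inv g \<in> {g \<in> carrier G. dist y (act g x) < r}" "g = inv (inv g)"
      using dist_act_left[of g y x] by (auto simp: dist_commute)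
    then show "g \<in> (\<lambda>g. inv g) ` {g \<in> carrier G. dist y (act g x) < r}" by blast
  qed
  then show ?thesis using finite_close_translates_of_source[OF fin] finite_subset by blast
qed

text \<open>
  Cover the core by translates of finitely many balls \<open>B(x, r\<^sub>x / 3)\<close>, where \<open>r\<^sub>x\<close> is a radius with
  finitely many returns.  If two points of the core at distance less than \<open>\<rho>\<close> lie in translates by \<open>g\<close>
  and \<open>g'\<close>, then \<open>g\<^sup>-\<^sup>1 g'\<close> brings some centre \<open>x'\<close> within \<open>max r\<^sub>x r\<^bsub>x'\<^esub>\<close> of a centre \<open>x\<close>, and the
  larger of the two radii leaves only finitely many possibilities \<open>S\<close>.  A geodesic from a point of
  the core to its translate by \<open>h\<close> stays in the core; walking along it in steps shorter than \<open>\<rho>\<close>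
  writes \<open>h\<close>, up to bounded factors, as a product of about \<open>dist / \<rho>\<close> elements of \<open>S\<close>.
\<close>

theorem svarc_milnor_lower_bound:
  fixes len :: "'a \<Rightarrow> nat"
  assumes geod: "\<And>x y :: 'x. \<exists>c. geodesic_segment x y c"
    and pd: "properly_discontinuous G act"
    and cc: "convex_cocompact G act b"
    and len: "\<And>g h. g \<in> carrier G \<Longrightarrow> h \<in> carrier G \<Longrightarrow> len (g \<otimes> h) \<le> len g + len h"
  shows "\<exists>a>0. \<exists>C\<ge>0. \<forall>g\<in>carrier G. a * real (len g) - C \<le> dist b (act g b)"
proof -
  define C where "C = convex_core G act b"
  obtain o' where o': "o' \<in> C" and cpt: "compact_space (orbit_space G act C)"
    using cc by (auto simp: convex_cocompact_def C_def)
  have "\<forall>x. \<exists>r. r > 0 \<and> finite {g \<in> carrier G. act g ` ball x r \<inter> ball x r \<noteq> {}}"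
    using locally_finite[OF pd] by (intro allI) simp
  from choice[OF this] obtain r where
    r_fin: "\<forall>x. r x > 0 \<and> finite {g \<in> carrier G. act g ` ball x (r x) \<inter> ball x (r x) \<noteq> {}}"
    by (elim exE)
  then have r: "r x > 0" and fin: "finite {g \<in> carrier G. act g ` ball x (r x) \<inter> ball x (r x) \<noteq> {}}" for x
    by simp_all
  obtain X where X: "X \<subseteq> C" "finite X"
    and cover: "\<And>y. y \<in> C \<Longrightarrow> \<exists>x\<in>X. \<exists>g\<in>carrier G. dist (act g x) y < r x / 3"
    using finite_cover[OF cpt, of "\<lambda>x. r x / 3"] r by auto
  have "X \<noteq> {}" using cover[OF o'] by blast
  define S where "S = (\<Union>x\<in>X. \<Union>x'\<in>X. {g \<in> carrier G. dist x (act g x') < max (r x) (r x')})"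
  have "finite S"
    unfolding S_def
  proof (intro finite_UN_I X)
    show "finite {g \<in> carrier G. dist x (act g x') < max (r x) (r x')}" for x x'
      using finite_close_translates_of_source[OF fin[of x]] finite_close_translates_of_target[OF fin[of x']]
      by (simp add: max_def)
  qed
  define M where "M = Suc (Max (len ` S))"
  have M: "len s \<le> M" if "s \<in> S" for s
    unfolding M_def using \<open>finite S\<close> that by (intro le_SucI Max_ge) auto
  define \<rho> where "\<rho> = Min (r ` X) / 3"
  have \<rho>: "\<rho> > 0" "\<And>x. x \<in> X \<Longrightarrow> \<rho> \<le> r x / 3"
    using X \<open>X \<noteq> {}\<close> r by (auto simp: \<rho>_def)
  have step: "inv g \<otimes> g' \<in> S"
    if "dist y y' < \<rho>" "x \<in> X" "x' \<in> X" "g \<in> carrier G" "g' \<in> carrier G"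
      "dist (act g x) y < r x / 3" "dist (act g' x') y' < r x' / 3" for y y' x x' g g'
  proof -
    have "dist (act g x) (act g' x') \<le> dist (act g x) y + dist y y' + dist (act g' x') y'"
      by metric
    also have "\<dots> < max (r x) (r x')" using that \<rho>(2)[of x] by auto
    finally have "dist x (act (inv g \<otimes> g') x') < max (r x) (r x')"
      using that by (simp add: act_mult dist_act_left)
    then show ?thesis using that by (auto simp: S_def)
  qed
  obtain x0 g0 where x0: "x0 \<in> X" "g0 \<in> carrier G" "dist (act g0 x0) o' < r x0 / 3"
    using cover[OF o'] by blast
  define K where "K = len g0 + len (inv g0) + len \<one>"
  have main: "real (len h) \<le> K + real M * (dist o' (act h o') / \<rho> + 2)" if h: "h \<in> carrier G" for h
  proof -
    define L where "L = dist o' (act h o')"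
    \<comment> \<open>the number of steps; the successor makes the steps strictly shorter than \<open>\<rho>\<close>\<close>
    define N where "N = Suc (nat \<lceil>L / \<rho>\<rceil>)"
    have L0: "L \<ge> 0" by (simp add: L_def)
    have "L / \<rho> \<ge> 0" using L0 \<rho> by simp
    then have N: "L / \<rho> < real N" "real N \<le> L / \<rho> + 2" unfolding N_def by linarith+
    then have N\<rho>: "L / real N < \<rho>" using \<rho>(1) by (simp add: N_def field_simps)
    have ho: "act h o' \<in> C" using convex_core_invariant[OF h] o' by (simp add: C_def)
    obtain c where c: "geodesic_segment o' (act h o') c" using geod by blast
    define P where "P i = c (real i * (L / N))" for i
    have P0: "P 0 = o'" "P N = act h o'" using c by (auto simp: P_def geodesic_segment_def L_def N_def)
    have iN: "real i * (L / N) \<in> {0..L}" if "i \<le> N" for i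
    proof -
      have "real i * L \<le> real N * L" using that L0 by (intro mult_right_mono) auto
      then show ?thesis using L0 by (simp add: N_def field_simps)
    qed
    have PC: "P i \<in> C" if "i \<le> N" for i
      using convex_core_convex[OF _ _ c] o' ho iN[OF that] by (simp add: C_def P_def L_def)
    have dP: "dist (P i) (P (Suc i)) < \<rho>" if "i < N" for i
    proof -
      have "dist (P i) (P (Suc i)) = \<bar>real i * (L / N) - real (Suc i) * (L / N)\<bar>"
        using c iN[of i] iN[of "Suc i"] that
        unfolding P_def geodesic_segment_def geodesic_on_def L_def by simp
      also have "\<dots> = L / N" using L0 by (simp add: algebra_simps flip: add_divide_distrib diff_divide_distrib)
      finally show ?thesis using N\<rho> by simp
    qed
    \<comment> \<open>at the two ends the translates are prescribed, so that they differ exactly by \<open>h\<close>\<close>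
    have "\<exists>x g. x \<in> X \<and> g \<in> carrier G \<and> (i \<le> N \<longrightarrow> dist (act g x) (P i) < r x / 3) \<and>
        (i = 0 \<longrightarrow> g = g0) \<and> (i = N \<longrightarrow> g = h \<otimes> g0)" for i
    proof -
      consider "i = 0" | "i = N" | "i \<noteq> 0" "i \<noteq> N" by blast
      then show ?thesis
      proof cases
        case 1
        then show ?thesis using x0 P0 by (intro exI[of _ x0] exI[of _ g0]) (auto simp: N_def)
      next
        case 2
        then show ?thesis using x0 P0 h
          by (intro exI[of _ x0] exI[of _ "h \<otimes> g0"]) (auto simp: N_def act_mult)
      next
        case 3
        then show ?thesis using cover[of "P i"] PC[of i] x0 by (cases "i \<le> N") blast+
      qed
    qed
    then obtain x g where xg: "\<And>i. x i \<in> X" "\<And>i. g i \<in> carrier G"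
      "\<And>i. i \<le> N \<Longrightarrow> dist (act (g i) (x i)) (P i) < r (x i) / 3" "g 0 = g0" "g N = h \<otimes> g0"
      by metis
    have "len (inv g0 \<otimes> g i) \<le> len \<one> + i * M" if "i \<le> N" for i
      using that
    proof (induction i)
      case 0
      then show ?case using x0 by (simp add: xg)
    next
      case (Suc i)
      have s: "inv (g i) \<otimes> g (Suc i) \<in> S"
        by (rule step[OF dP[of i] xg(1)[of i] xg(1)[of "Suc i"]]) (use xg Suc in auto)
      have "inv g0 \<otimes> g (Suc i) = (inv g0 \<otimes> g i) \<otimes> (inv (g i) \<otimes> g (Suc i))"
        using xg x0 by (simp add: m_assoc mult_inv_cancel)
      then have "len (inv g0 \<otimes> g (Suc i)) \<le> len (inv g0 \<otimes> g i) + len (inv (g i) \<otimes> g (Suc i))"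
        using len xg x0 by simp
      also have "\<dots> \<le> len \<one> + i * M + M" using M[OF s] Suc by simp
      finally show ?case by simp
    qed
    from this[of N] have "len (inv g0 \<otimes> g N) \<le> len \<one> + N * M" by simp
    moreover have "len h \<le> len g0 + len (inv g0 \<otimes> g N) + len (inv g0)"
    proof -
      have "h = (g0 \<otimes> (inv g0 \<otimes> g N)) \<otimes> inv g0"
        using x0 h by (simp add: xg m_assoc mult_inv_cancel)
      then have "len h \<le> len (g0 \<otimes> (inv g0 \<otimes> g N)) + len (inv g0)"
        using len[of "g0 \<otimes> (inv g0 \<otimes> g N)" "inv g0"] x0 xg(2)[of N] by simp
      then show ?thesis using len[of g0 "inv g0 \<otimes> g N"] x0 xg(2)[of N] by simp
    qed
    ultimately have "len h \<le> K + N * M" by (simp add: K_def)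
    then have "real (len h) \<le> real (K + N * M)" by (simp only: of_nat_le_iff)
    also have "\<dots> = K + real M * real N" by (simp add: mult.commute)
    also have "\<dots> \<le> K + real M * (L / \<rho> + 2)" using N by (intro add_left_mono mult_left_mono) auto
    finally show ?thesis by (simp add: L_def)
  qed
  have M0: "real M > 0" by (simp add: M_def)
  show ?thesis
  proof (rule exI[of _ "\<rho> / M"], intro exI[of _ "(K + 2 * real M) * (\<rho> / M) + 2 * dist b o'"] conjI ballI)
    fix g assume g: "g \<in> carrier G"
    have "dist o' (act g o') \<le> dist o' b + dist b (act g b) + dist (act g b) (act g o')" by metric
    then have le: "dist o' (act g o') - 2 * dist b o' \<le> dist b (act g b)"
      using g by (simp add: dist_commute)
    have "\<rho> / M * len g \<le> \<rho> / M * (K + real M * (dist o' (act g o') / \<rho> + 2))"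
      using main[OF g] M0 \<rho> by (intro mult_left_mono) auto
    also have "\<dots> = (K + 2 * real M) * (\<rho> / M) + dist o' (act g o')"
      using M0 \<rho>(1) by (simp add: field_simps)
    finally show "\<rho> / M * len g - ((K + 2 * real M) * (\<rho> / M) + 2 * dist b o') \<le> dist b (act g b)"
      using le by linarith
  qed (use M0 \<rho> in auto)
qed

end

section \<open>Reduced words and conjugacy classes in a free group\<close>

definition inv_letter :: "'g \<times> bool \<Rightarrow> 'g \<times> bool" where
  "inv_letter l = (fst l, \<not> snd l)"

definition inv_word :: "('g \<times> bool) list \<Rightarrow> ('g \<times> bool) list" where
  "inv_word w = rev (map inv_letter w)"

lemma inv_letter_inv_letter [simp]: "inv_letter (inv_letter l) = l"
  by (simp add: inv_letter_def)

lemma inv_letter_neq [simp]: "inv_letter l \<noteq> l" "l \<noteq> inv_letter l"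
  by (simp_all add: inv_letter_def prod_eq_iff)

lemma inv_letter_eq_iff: "inv_letter l = l' \<longleftrightarrow> l = inv_letter l'"
  by (auto simp: inv_letter_def prod_eq_iff)

lemma inv_letter_mem_iff [simp]: "inv_letter l \<in> A \<times> UNIV \<longleftrightarrow> l \<in> A \<times> UNIV"
  by (auto simp: inv_letter_def mem_Times_iff)

lemma length_inv_word [simp]: "length (inv_word w) = length w"
  by (simp add: inv_word_def)

lemma inv_word_append: "inv_word (u @ v) = inv_word v @ inv_word u"
  by (simp add: inv_word_def)

lemma inv_word_simps [simp]: "inv_word [] = []" "inv_word [l] = [inv_letter l]"
  by (simp_all add: inv_word_def)

lemma inv_word_inv_word [simp]: "inv_word (inv_word w) = w"
  by (simp add: inv_word_def rev_map comp_def)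

lemma inv_word_eq_Nil_iff [simp]: "inv_word w = [] \<longleftrightarrow> w = []"
  by (simp add: inv_word_def)

lemma last_inv_word: "w \<noteq> [] \<Longrightarrow> last (inv_word w) = inv_letter (hd w)"
  by (simp add: inv_word_def last_rev hd_map)

lemma inv_word_mem_iff [simp]: "inv_word w \<in> group_words A \<longleftrightarrow> w \<in> group_words A"
  by (auto simp: inv_word_def group_words_def in_lists_conv_set)

lemma group_words_append [simp]:
  "u @ v \<in> group_words A \<longleftrightarrow> u \<in> group_words A \<and> v \<in> group_words A"
  by (auto simp: group_words_def)

lemma group_words_Cons [simp]:
  "l # v \<in> group_words A \<longleftrightarrow> l \<in> A \<times> UNIV \<and> v \<in> group_words A"
  by (auto simp: group_words_def)

lemma Nil_in_group_words [simp]: "[] \<in> group_words A"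
  by (auto simp: group_words_def)

lemma reduced_word_iff: "reduced_word w \<longleftrightarrow> successively (\<lambda>l l'. l' \<noteq> inv_letter l) w"
  unfolding reduced_word_def inv_letter_def
  by (rule arg_cong[of _ _ "\<lambda>P. successively P w"]) (auto simp: fun_eq_iff prod_eq_iff)

lemma reduced_word_append:
  "reduced_word (u @ v) \<longleftrightarrow>
     reduced_word u \<and> reduced_word v \<and> (u = [] \<or> v = [] \<or> hd v \<noteq> inv_letter (last u))"
  by (simp add: reduced_word_iff successively_append_iff)

lemma reduced_word_Cons:
  "reduced_word (l # w) \<longleftrightarrow> w = [] \<or> hd w \<noteq> inv_letter l \<and> reduced_word w"
  by (simp add: reduced_word_iff successively_Cons)

lemma reduced_word_short [simp]: "reduced_word []" "reduced_word [l]"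
  by (simp_all add: reduced_word_iff)

lemma reduced_word_inv_word [simp]: "reduced_word (inv_word w) \<longleftrightarrow> reduced_word w"
proof (induction w)
  case (Cons l w)
  have "inv_word (l # w) = inv_word w @ [inv_letter l]" using inv_word_append[of "[l]" w] by simp
  then show ?case using Cons
    by (auto simp: reduced_word_append reduced_word_Cons last_inv_word inv_letter_eq_iff)
qed simp

definition cyclically_reduced :: "('g \<times> bool) list \<Rightarrow> bool" where
  "cyclically_reduced w \<longleftrightarrow> reduced_word w \<and> (w \<noteq> [] \<longrightarrow> hd w \<noteq> inv_letter (last w))"

definition conj_word :: "('g \<times> bool) list \<Rightarrow> ('g \<times> bool) list \<Rightarrow> ('g \<times> bool) list" where
  "conj_word u z = inv_word u @ z @ u"

lemma conj_word_mem_iff [simp]: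
  "conj_word u z \<in> group_words A \<longleftrightarrow> u \<in> group_words A \<and> z \<in> group_words A"
  by (auto simp: conj_word_def)

lemma length_conj_word [simp]: "length (conj_word u z) = length z + 2 * length u"
  by (simp add: conj_word_def)

lemma conj_word_inject:
  assumes "length u = length u'" "length z = length z'"
  shows "conj_word u z = conj_word u' z' \<longleftrightarrow> u = u' \<and> z = z'"
  using assms by (auto simp: conj_word_def)

lemma reduced_conj_word:
  assumes "z \<noteq> []" "u \<noteq> []"
  shows "reduced_word (conj_word u z) \<longleftrightarrow>
           reduced_word u \<and> reduced_word z \<and> hd u \<noteq> hd z \<and> hd u \<noteq> inv_letter (last z)"
  using assms by (auto simp: conj_word_def reduced_word_append last_inv_word)

text \<open>
  Meant for \<open>n > 0\<close>; for \<open>n = 0\<close> it depends on the unspecified head of the empty word.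
\<close>

definition words_from :: "'g set \<Rightarrow> 'g \<times> bool \<Rightarrow> nat \<Rightarrow> ('g \<times> bool) list set" where
  "words_from A l n = {w \<in> group_words A. reduced_word w \<and> length w = n \<and> hd w = l}"

lemma words_from_one: "l \<in> A \<times> UNIV \<Longrightarrow> words_from A l (Suc 0) = {[l]}"
  by (auto simp: words_from_def length_Suc_conv)

lemma words_from_Suc:
  assumes "l \<in> A \<times> UNIV" "n > 0"
  shows "words_from A l (Suc n) = Cons l ` (\<Union>l'\<in>A \<times> UNIV - {inv_letter l}. words_from A l' n)"
proof (intro equalityI subsetI)
  fix w assume w: "w \<in> words_from A l (Suc n)"
  then obtain v where v: "w = l # v" "length v = n" by (auto simp: words_from_def length_Suc_conv)
  then obtain m y where m: "v = m # y" using assms by (cases v) auto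
  then have "v \<in> words_from A m n" "m \<in> A \<times> UNIV - {inv_letter l}"
    using w v by (simp_all add: words_from_def reduced_word_Cons)
  then show "w \<in> Cons l ` (\<Union>l'\<in>A \<times> UNIV - {inv_letter l}. words_from A l' n)" using v by blast
qed (use assms in \<open>auto simp: words_from_def reduced_word_Cons\<close>)

lemma finite_words_from: "finite A \<Longrightarrow> finite (words_from A l n)"
  unfolding words_from_def group_words_def lists_eq_set
  by (rule finite_subset[OF _ finite_lists_length_eq[of "A \<times> UNIV" n]]) auto

lemma words_from_disjoint: "l \<noteq> l' \<Longrightarrow> words_from A l n \<inter> words_from A l' n = {}"
  by (auto simp: words_from_def)

lemma sum_words_from_Suc:
  assumes "finite A" "l \<in> A \<times> UNIV" "n > 0"
  shows "(\<Sum>w\<in>words_from A l (Suc n). f w) =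
         (\<Sum>l'\<in>A \<times> UNIV - {inv_letter l}. \<Sum>v\<in>words_from A l' n. f (l # v))"
proof -
  have "(\<Sum>w\<in>words_from A l (Suc n). f w) =
        (\<Sum>v\<in>(\<Union>l'\<in>A \<times> UNIV - {inv_letter l}. words_from A l' n). f (l # v))"
    unfolding words_from_Suc[OF assms(2,3)] by (subst sum.reindex) (auto simp: inj_on_def)
  also have "\<dots> = (\<Sum>l'\<in>A \<times> UNIV - {inv_letter l}. \<Sum>v\<in>words_from A l' n. f (l # v))"
    using assms by (subst sum.UNION_disjoint) (auto simp: finite_words_from words_from_disjoint)
  finally show ?thesis .
qed

lemma card_letters: "finite A \<Longrightarrow> card (A \<times> (UNIV :: bool set)) = 2 * card A"
  by (simp add: card_cartesian_product)

lemma card_words_from: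
  assumes "finite A" "l \<in> A \<times> UNIV"
  shows "card (words_from A l (Suc n)) = (2 * card A - 1) ^ n"
  using assms(2)
proof (induction n arbitrary: l)
  case (Suc n)
  have "card (words_from A l (Suc (Suc n))) =
        (\<Sum>l'\<in>A \<times> UNIV - {inv_letter l}. card (words_from A l' (Suc n)))"
    using sum_words_from_Suc[OF assms(1) Suc.prems, of "Suc n" "\<lambda>_. 1 :: nat"] by simp
  also have "\<dots> = card (A \<times> (UNIV :: bool set) - {inv_letter l}) * (2 * card A - 1) ^ n"
    using Suc.IH by simp
  also have "card (A \<times> (UNIV :: bool set) - {inv_letter l}) = 2 * card A - 1"
    by (simp only: card_Diff_singleton inv_letter_mem_iff Suc.prems card_letters assms(1))
  finally show ?case by simp
qed (simp add: words_from_one)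

locale free_group = group G for G (structure) +
  fixes A :: "'a set"
  assumes free: "free_generating_set G A"
begin

abbreviation val :: "('a \<times> bool) list \<Rightarrow> 'a" where "val \<equiv> word_val G"

abbreviation len :: "'a \<Rightarrow> nat" where "len \<equiv> word_length G A"

lemma letter_val_closed: "l \<in> A \<times> UNIV \<Longrightarrow> letter_val G l \<in> carrier G"
  using free by (auto simp: letter_val_def free_generating_set_def)

lemma letter_val_inv_letter: "l \<in> A \<times> UNIV \<Longrightarrow> letter_val G (inv_letter l) = inv (letter_val G l)"
  using free by (auto simp: letter_val_def free_generating_set_def inv_letter_def)

lemma val_Nil [simp]: "val [] = \<one>"
  by (simp add: word_val_def)

lemma val_Cons: "val (l # w) = letter_val G l \<otimes> val w"
  by (simp add: word_val_def)

lemma val_closed [simp]: "w \<in> group_words A \<Longrightarrow> val w \<in> carrier G"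
  by (induction w) (auto simp: val_Cons letter_val_closed)

lemma val_append: "u \<in> group_words A \<Longrightarrow> v \<in> group_words A \<Longrightarrow> val (u @ v) = val u \<otimes> val v"
  by (induction u) (auto simp: val_Cons letter_val_closed m_assoc)

lemma val_inv_word: "w \<in> group_words A \<Longrightarrow> val (inv_word w) = inv (val w)"
proof (induction w)
  case (Cons l w)
  have "inv_word (l # w) = inv_word w @ [inv_letter l]" using inv_word_append[of "[l]" w] by simp
  then show ?case using Cons
    by (simp add: val_append val_Cons letter_val_closed letter_val_inv_letter inv_mult_group)
qed simp

lemma val_conj_word:
  "u \<in> group_words A \<Longrightarrow> z \<in> group_words A \<Longrightarrow> val (conj_word u z) = inv (val u) \<otimes> val z \<otimes> val u"
  by (simp add: conj_word_def val_append val_inv_word m_assoc)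

lemma bij_val: "bij_betw val {w \<in> group_words A. reduced_word w} (carrier G)"
  using free by (simp add: free_generating_set_def)

lemma inj_on_val: "inj_on val {w \<in> group_words A. reduced_word w}"
  using bij_val by (rule bij_betw_imp_inj_on)

lemma ex_reduced_word:
  assumes "x \<in> carrier G"
  shows "\<exists>w\<in>group_words A. reduced_word w \<and> val w = x"
proof -
  have "x \<in> val ` {w \<in> group_words A. reduced_word w}"
    using assms by (simp only: bij_betw_imp_surj_on[OF bij_val])
  then show ?thesis by auto
qed

lemma not_reduced_wordE:
  assumes "\<not> reduced_word w"
  obtains u l v where "w = u @ [l, inv_letter l] @ v"
  using assms
proof (induction w arbitrary: thesis)
  case (Cons l w)
  then have *: "w \<noteq> []" "hd w = inv_letter l \<or> \<not> reduced_word w" by (auto simp: reduced_word_Cons)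
  show ?case
  proof (cases "hd w = inv_letter l")
    case True
    then show ?thesis using Cons.prems(1)[of "[]" l "tl w"] * by (cases w) auto
  next
    case False
    then show ?thesis using * Cons.IH Cons.prems(1) by (metis append_Cons)
  qed
qed simp

lemma len_le: "w \<in> group_words A \<Longrightarrow> len (val w) \<le> length w"
  unfolding word_length_def by (rule Least_le) auto

text \<open>
  A shortest word for an element is reduced, and there is only one reduced word.
\<close>

lemma len_val:
  assumes "w \<in> group_words A" "reduced_word w"
  shows "len (val w) = length w"
proof -
  have "\<exists>v\<in>group_words A. length v = len (val w) \<and> val v = val w"
    unfolding word_length_def by (rule LeastI_ex) (use assms in auto)
  then obtain v where v: "v \<in> group_words A" "length v = len (val w)" "val v = val w" by blast
  have "reduced_word v"
  proof (rule ccontr)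
    assume "\<not> reduced_word v"
    then obtain x l y where v': "v = x @ [l, inv_letter l] @ y" by (rule not_reduced_wordE)
    then have "val (x @ y) = val v"
      using v(1) by (simp add: val_append val_Cons letter_val_closed letter_val_inv_letter
          mult_inv_cancel)
    then have "len (val w) \<le> length (x @ y)" using len_le[of "x @ y"] v v' by simp
    then show False using v(2) v' by simp
  qed
  then have "v = w" using inj_on_val v assms by (auto simp: inj_on_def)
  then show ?thesis using v by simp
qed

lemma len_mult_le:
  assumes "x \<in> carrier G" "y \<in> carrier G"
  shows "len (x \<otimes> y) \<le> len x + len y"
proof -
  obtain u v where "u \<in> group_words A" "reduced_word u" "val u = x"
    "v \<in> group_words A" "reduced_word v" "val v = y" using assms ex_reduced_word by metis
  then show ?thesis using len_le[of "u @ v"] by (auto simp: val_append len_val)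
qed

lemma word_sphere_eq:
  "word_sphere G A n = val ` {w \<in> group_words A. reduced_word w \<and> length w = n}"
  using ex_reduced_word by (fastforce simp: word_sphere_def len_val)

text \<open>
  Conjugating \<open>u\<^sup>-\<^sup>1 z u\<close> by a letter lengthens or shortens \<open>u\<close>; if \<open>u\<close> is empty, it may instead
  rotate \<open>z\<close> cyclically.  None of this changes the length of the cyclically reduced part.
\<close>

lemma conj_word_step:
  assumes z: "z \<in> group_words A" "cyclically_reduced z" "z \<noteq> []"
    and u: "u \<in> group_words A" "reduced_word (conj_word u z)" and l: "l \<in> A \<times> UNIV"
  shows "\<exists>u' z'. u' \<in> group_words A \<and> z' \<in> group_words A \<and> cyclically_reduced z' \<and>
           length z' = length z \<and> reduced_word (conj_word u' z') \<and>
           val (conj_word u' z') = inv (letter_val G l) \<otimes> val (conj_word u z) \<otimes> letter_val G l"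
    (is "\<exists>u' z'. ?P u' z'")
proof (cases u rule: rev_cases)
  case (snoc v m)
  have m: "m \<in> A \<times> UNIV" "v \<in> group_words A" using u snoc by auto
  have cu: "conj_word u z = [inv_letter m] @ conj_word v z @ [m]"
    by (simp add: snoc conj_word_def inv_word_append)
  show ?thesis
  proof (cases "l = inv_letter m")
    case True
    have "reduced_word (conj_word v z)" using u unfolding cu by (auto simp: reduced_word_append reduced_word_Cons)
    moreover have "val (conj_word v z) = inv (letter_val G l) \<otimes> val (conj_word u z) \<otimes> letter_val G l"
      using m z by (simp add: True cu letter_val_inv_letter letter_val_closed val_append val_Cons
         m_assoc mult_inv_cancel)
    ultimately show ?thesis using z m by blast
  next
    case False
    have cl: "conj_word (u @ [l]) z = [inv_letter l] @ conj_word u z @ [l]"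
      by (simp add: conj_word_def inv_word_append)
    have "hd (conj_word u z) = inv_letter m" "last (conj_word u z) = m" "conj_word u z \<noteq> []" by (auto simp: cu)
    then have "reduced_word (conj_word (u @ [l]) z)"
      unfolding cl using u False by (auto simp: reduced_word_append reduced_word_Cons inv_letter_eq_iff)
    moreover have "val (conj_word (u @ [l]) z) = inv (letter_val G l) \<otimes> val (conj_word u z) \<otimes> letter_val G l"
      unfolding cl using l z u
      by (simp add: letter_val_inv_letter letter_val_closed val_append val_Cons m_assoc)
    ultimately show ?thesis using z u l by (intro exI[of _ "u @ [l]"] exI[of _ z]) auto
  qed
next
  case Nil
  have red: "reduced_word z" "hd z \<noteq> inv_letter (last z)" using z by (auto simp: cyclically_reduced_def)
  have cz: "conj_word u z = z" by (simp add: Nil conj_word_def)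
  consider "hd z = l" | "last z = inv_letter l" | "hd z \<noteq> l" "last z \<noteq> inv_letter l" by blast
  then show ?thesis
  proof cases
    case 1
    then obtain y where y: "z = l # y" using z by (cases z) auto
    have "cyclically_reduced (y @ [l])"
      using red y by (cases "y = []") (auto simp: cyclically_reduced_def reduced_word_append reduced_word_Cons)
    moreover have "val (y @ [l]) = inv (letter_val G l) \<otimes> val z \<otimes> letter_val G l"
      using z y l by (simp add: val_append val_Cons letter_val_closed m_assoc mult_inv_cancel)
    ultimately show ?thesis unfolding cz using z y
      by (intro exI[of _ "[]"] exI[of _ "y @ [l]"]) (auto simp: conj_word_def cyclically_reduced_def)
  next
    case 2
    then obtain y where y: "z = y @ [inv_letter l]" using z by (cases z rule: rev_cases) auto
    have "cyclically_reduced (inv_letter l # y)"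
      using red y by (cases "y = []") (auto simp: cyclically_reduced_def reduced_word_append reduced_word_Cons)
    moreover have "val (inv_letter l # y) = inv (letter_val G l) \<otimes> val z \<otimes> letter_val G l"
      using z y l by (simp add: val_append val_Cons letter_val_closed letter_val_inv_letter m_assoc)
    ultimately show ?thesis unfolding cz using z y
      by (intro exI[of _ "[]"] exI[of _ "inv_letter l # y"]) (auto simp: conj_word_def cyclically_reduced_def)
  next
    case 3
    then have "reduced_word (conj_word [l] z)"
      using red z by (subst reduced_conj_word) (auto simp: inv_letter_eq_iff)
    moreover have "val (conj_word [l] z) = inv (letter_val G l) \<otimes> val z \<otimes> letter_val G l"
      using z l by (simp add: val_conj_word val_Cons letter_val_closed)
    ultimately show ?thesis unfolding cz using z l by (intro exI[of _ "[l]"] exI[of _ z]) auto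
  qed
qed

lemma conj_normal_form:
  assumes z: "z \<in> group_words A" "cyclically_reduced z" "z \<noteq> []" and v: "v \<in> group_words A"
  shows "\<exists>u' z'. u' \<in> group_words A \<and> z' \<in> group_words A \<and> cyclically_reduced z' \<and>
           length z' = length z \<and> reduced_word (conj_word u' z') \<and>
           val (conj_word u' z') = inv (val v) \<otimes> val z \<otimes> val v"
  using v
proof (induction v rule: rev_induct)
  case Nil
  then show ?case using z
    by (intro exI[of _ "[]"] exI[of _ z]) (auto simp: conj_word_def cyclically_reduced_def)
next
  case (snoc l v)
  then obtain u' z' where IH: "u' \<in> group_words A" "z' \<in> group_words A" "cyclically_reduced z'"
     "length z' = length z" "reduced_word (conj_word u' z')"
     "val (conj_word u' z') = inv (val v) \<otimes> val z \<otimes> val v" by auto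
  have "z' \<noteq> []" using IH z by auto
  moreover have "inv (letter_val G l) \<otimes> val (conj_word u' z') \<otimes> letter_val G l =
      inv (val (v @ [l])) \<otimes> val z \<otimes> val (v @ [l])"
    using IH(6) snoc.prems z
    by (simp add: val_append val_Cons letter_val_closed inv_mult_group m_assoc)
  ultimately show ?case using conj_word_step[OF IH(2,3) _ IH(1,5), of l] snoc.prems IH(4) by auto
qed

definition cyclic_reps :: "'a set \<Rightarrow> ('a \<times> bool) list set" where
  "cyclic_reps C = {z \<in> group_words A. cyclically_reduced z \<and> val z \<in> C}"

lemma conjugacy_class_closed:
  assumes C: "C \<in> conjugacy_classes G" and "y \<in> C" "h \<in> carrier G"
  shows "inv h \<otimes> y \<otimes> h \<in> C"
proof -
  obtain x g where x: "x \<in> carrier G" "C = conjugacy_class G x" "g \<in> carrier G" "y = g \<otimes> x \<otimes> inv g"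
    using C \<open>y \<in> C\<close> by (auto simp: conjugacy_classes_def conjugacy_class_def)
  have "inv h \<otimes> y \<otimes> h = (inv h \<otimes> g) \<otimes> x \<otimes> inv (inv h \<otimes> g)"
    using x assms by (simp add: inv_mult_group m_assoc)
  moreover have "inv h \<otimes> g \<in> carrier G" using x assms by simp
  ultimately show ?thesis unfolding x(2) conjugacy_class_def by blast
qed

lemma conjugacy_class_transitive:
  assumes C: "C \<in> conjugacy_classes G" and "y \<in> C" "y' \<in> C"
  shows "\<exists>h\<in>carrier G. y' = inv h \<otimes> y \<otimes> h"
proof -
  obtain x g g' where x: "x \<in> carrier G" "g \<in> carrier G" "y = g \<otimes> x \<otimes> inv g"
    "g' \<in> carrier G" "y' = g' \<otimes> x \<otimes> inv g'"
    using assms by (auto simp: conjugacy_classes_def conjugacy_class_def)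
  then have "y' = inv (g \<otimes> inv g') \<otimes> y \<otimes> (g \<otimes> inv g')"
    by (simp add: inv_mult_group m_assoc mult_inv_cancel)
  then show ?thesis using x by blast
qed

lemma conjugacy_class_subset: "C \<in> conjugacy_classes G \<Longrightarrow> C \<subseteq> carrier G"
  by (auto simp: conjugacy_classes_def conjugacy_class_def)

text \<open>
  An element of minimal length in the class is cyclically reduced, because otherwise conjugation by
  its last letter would shorten it.
\<close>

lemma ex_cyclic_rep:
  assumes C: "C \<in> conjugacy_classes G"
  shows "\<exists>z. z \<in> cyclic_reps C \<and> length z = (LEAST n. \<exists>x\<in>C. len x = n)"
proof -
  let ?k = "LEAST n. \<exists>x\<in>C. len x = n"
  obtain x0 where "x0 \<in> C"
    using C one_closed by (auto simp: conjugacy_classes_def conjugacy_class_def)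
  then have "\<exists>x\<in>C. len x = ?k" by (intro LeastI_ex[of "\<lambda>n. \<exists>x\<in>C. len x = n"]) auto
  then obtain x where x: "x \<in> C" "len x = ?k" by blast
  obtain w where w: "w \<in> group_words A" "reduced_word w" "val w = x"
    using ex_reduced_word x conjugacy_class_subset[OF C] by blast
  then have lw: "length w = ?k" using x len_val by metis
  have "cyclically_reduced w"
    unfolding cyclically_reduced_def
  proof (intro conjI w impI notI)
    assume "w \<noteq> []" and hl: "hd w = inv_letter (last w)"
    then obtain y m where y: "w = y @ [m]" by (cases w rule: rev_cases) auto
    then have "y \<noteq> []" using hl by auto
    then obtain v where v: "y = inv_letter m # v" using hl y by (cases y) auto
    have wv: "w = [inv_letter m] @ v @ [m]" by (simp add: y v)
    have m: "m \<in> A \<times> UNIV" "v \<in> group_words A" using w wv by auto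
    have "val v = inv (inv (letter_val G m)) \<otimes> x \<otimes> inv (letter_val G m)"
      using m unfolding w(3)[symmetric] wv
      by (simp add: val_append val_Cons letter_val_closed letter_val_inv_letter m_assoc mult_inv_cancel)
    then have "val v \<in> C"
      using conjugacy_class_closed[OF C x(1) inv_closed[OF letter_val_closed[OF m(1)]]] by simp
    then have "?k \<le> len (val v)" by (intro Least_le) auto
    also have "\<dots> \<le> length v" using m len_le by blast
    finally show False using lw wv by simp
  qed
  then show ?thesis using w x lw by (auto simp: cyclic_reps_def)
qed

lemma trivial_conjugacy_class:
  assumes C: "C \<in> conjugacy_classes G" and "\<one> \<in> C"
  shows "C = {\<one>}"
  using conjugacy_class_transitive[OF C \<open>\<one> \<in> C\<close>] \<open>\<one> \<in> C\<close> by fastforce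

text \<open>
  Starting from one cyclically reduced representative, every element of the class has the form
  \<open>u\<^sup>-\<^sup>1 z u\<close> without cancellation.  Its length then determines the length of \<open>u\<close>, and the reduced word
  determines \<open>u\<close> and \<open>z\<close>.
\<close>

theorem conjugacy_class_sphere:
  assumes C: "C \<in> conjugacy_classes G" "C \<noteq> {\<one>}" and k: "k = (LEAST n. \<exists>x\<in>C. len x = n)"
  shows "k > 0"
    and "\<And>z. z \<in> cyclic_reps C \<Longrightarrow> length z = k"
    and "bij_betw (\<lambda>(z, u). val (conj_word u z))
           {(z, u). z \<in> cyclic_reps C \<and> u \<in> group_words A \<and> length u = m \<and> reduced_word (conj_word u z)}
           (C \<inter> word_sphere G A (k + 2 * m))"
proof -
  have one: "\<one> \<notin> C" using trivial_conjugacy_class C by blast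
  have ne: "z \<noteq> []" if "z \<in> cyclic_reps C" for z
    using that one by (auto simp: cyclic_reps_def)
  obtain z0 where z0: "z0 \<in> cyclic_reps C" "length z0 = k" using ex_cyclic_rep[OF C(1)] k by blast
  then show k0: "k > 0" using ne by auto
  have nf: "\<exists>u' z'. u' \<in> group_words A \<and> z' \<in> cyclic_reps C \<and>
           length z' = length z \<and> reduced_word (conj_word u' z') \<and> val (conj_word u' z') = x"
    if z: "z \<in> cyclic_reps C" and x: "x \<in> C" for x z
  proof -
    obtain h where h: "h \<in> carrier G" "x = inv h \<otimes> val z \<otimes> h"
      using conjugacy_class_transitive[OF C(1) _ x] z by (auto simp: cyclic_reps_def)
    obtain v where v: "v \<in> group_words A" "val v = h" using ex_reduced_word h by blast
    obtain u' z' where *: "u' \<in> group_words A" "z' \<in> group_words A" "cyclically_reduced z'"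
           "length z' = length z" "reduced_word (conj_word u' z')" "val (conj_word u' z') = x"
      using conj_normal_form[of z v] z ne[OF z] v h by (auto simp: cyclic_reps_def)
    have x_eq: "x = inv (val u') \<otimes> val z' \<otimes> val u'"
      using *(6) val_conj_word[OF *(1,2)] by simp
    have "val z' = inv (inv (val u')) \<otimes> x \<otimes> inv (val u')"
      using *(1,2) by (subst x_eq) (simp add: m_assoc mult_inv_cancel)
    then have "val z' \<in> C"
      using conjugacy_class_closed[OF C(1) x, of "inv (val u')"] *(1) by (simp del: inv_inv)
    then show ?thesis using * by (auto simp: cyclic_reps_def)
  qed
  show lz: "length z = k" if z: "z \<in> cyclic_reps C" for z
  proof (rule antisym)
    have "len (val z) = length z" using z by (auto simp: cyclic_reps_def cyclically_reduced_def len_val)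
    then show "k \<le> length z" unfolding k by (intro Least_le) (use z in \<open>auto simp: cyclic_reps_def\<close>)
    obtain u' z' where *: "u' \<in> group_words A" "z' \<in> cyclic_reps C"
      "length z' = length z" "reduced_word (conj_word u' z')" "val (conj_word u' z') = val z0"
      using nf[OF z, of "val z0"] z0 by (auto simp: cyclic_reps_def)
    then have "conj_word u' z' = z0"
      using inj_on_val z0 by (auto simp: cyclic_reps_def cyclically_reduced_def inj_on_def)
    then show "length z \<le> k" using * z0(2) length_conj_word[of u' z'] by (metis le_add1)
  qed
  show "bij_betw (\<lambda>(z, u). val (conj_word u z))
           {(z, u). z \<in> cyclic_reps C \<and> u \<in> group_words A \<and> length u = m \<and> reduced_word (conj_word u z)}
           (C \<inter> word_sphere G A (k + 2 * m))" (is "bij_betw ?f ?D ?S")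
    unfolding bij_betw_def
  proof
    show "inj_on ?f ?D"
    proof (rule inj_onI, clarify)
      fix z u z' u'
      assume *: "val (conj_word u z) = val (conj_word u' z')" "length u' = length u"
         "z \<in> cyclic_reps C" "u \<in> group_words A" "reduced_word (conj_word u z)"
         "z' \<in> cyclic_reps C" "u' \<in> group_words A" "reduced_word (conj_word u' z')"
      then have "conj_word u z = conj_word u' z'"
        using inj_on_val by (auto simp: inj_on_def cyclic_reps_def)
      then show "z = z' \<and> u = u'" using * lz by (subst (asm) conj_word_inject) auto
    qed
    show "?f ` ?D = ?S"
    proof (intro equalityI subsetI)
      fix x assume "x \<in> ?f ` ?D"
      then obtain z u where *: "z \<in> cyclic_reps C" "u \<in> group_words A" "length u = m"
        "reduced_word (conj_word u z)" "x = val (conj_word u z)" by auto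
      then have "x \<in> C"
        using conjugacy_class_closed[OF C(1), of "val z" "val u"] by (auto simp: cyclic_reps_def val_conj_word)
      moreover have "len x = k + 2 * m" using * lz by (auto simp: len_val cyclic_reps_def)
      ultimately show "x \<in> ?S" using conjugacy_class_subset[OF C(1)] by (auto simp: word_sphere_def)
    next
      fix x assume x: "x \<in> ?S"
      then obtain u z where *: "u \<in> group_words A" "z \<in> cyclic_reps C"
         "reduced_word (conj_word u z)" "val (conj_word u z) = x"
        using nf[OF z0(1)] by blast
      then have "len x = k + 2 * length u" using len_val[of "conj_word u z"] lz by (auto simp: cyclic_reps_def)
      then have "length u = m" using x by (simp add: word_sphere_def)
      then show "x \<in> ?f ` ?D" using * by (intro image_eqI[of _ _ "(z, u)"]) auto
    qed
  qed
qed

end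

section \<open>Displacement along a conjugate\<close>

locale free_isometric_action =
  isometric_group_action G act + free_group G A
  for G (structure) and act :: "'a \<Rightarrow> 'x::metric_space \<Rightarrow> 'x" and A +
  fixes b :: 'x
  assumes finite_A: "finite A"
begin

definition disp :: "('a \<times> bool) list \<Rightarrow> real" where
  "disp w = dist b (act (val w) b)"

definition letter_disp_bound :: real where
  "letter_disp_bound = (\<Sum>l\<in>A \<times> UNIV. dist b (act (letter_val G l) b))"

lemma letter_disp_bound_nonneg: "letter_disp_bound \<ge> 0"
  unfolding letter_disp_bound_def by (intro sum_nonneg) auto

lemma dist_letter_le:
  assumes "l \<in> A \<times> UNIV"
  shows "dist b (act (letter_val G l) b) \<le> letter_disp_bound"
  unfolding letter_disp_bound_def
  by (rule member_le_sum[OF assms, of "\<lambda>l. dist b (act (letter_val G l) b)"]) (use finite_A in auto)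

lemma dist_act_mult_le:
  assumes "g \<in> carrier G" "h \<in> carrier G"
  shows "\<bar>dist b (act (g \<otimes> h) b) - dist b (act h b)\<bar> \<le> dist b (act g b)"
proof -
  have "dist b (act (g \<otimes> h) b) = dist (act (inv g) b) (act h b)"
    using assms dist_act_left[of "inv g" b "act h b"] by (simp add: act_mult)
  moreover have "dist (act (inv g) b) b = dist b (act g b)" using assms dist_act_left[of "inv g" b b] by simp
  moreover have "\<bar>dist x z - dist y z\<bar> \<le> dist x y" for x y z :: 'x by metric
  ultimately show ?thesis by (metis dist_commute)
qed

lemma disp_Cons:
  assumes "l \<in> A \<times> UNIV" "v \<in> group_words A"
  shows "\<bar>disp (l # v) - disp v\<bar> \<le> letter_disp_bound"
  using dist_act_mult_le[of "letter_val G l" "val v"] dist_letter_le[OF assms(1)] assms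
  by (simp add: disp_def val_Cons letter_val_closed)

lemma disp_le: "w \<in> group_words A \<Longrightarrow> disp w \<le> letter_disp_bound * real (length w)"
proof (induction w)
  case (Cons l w)
  then have "disp (l # w) \<le> disp w + letter_disp_bound" using disp_Cons[of l w] by (auto simp: abs_le_iff)
  also have "\<dots> \<le> letter_disp_bound * real (length (l # w))" using Cons by (simp add: algebra_simps)
  finally show ?case .
qed (simp add: disp_def)

lemma disp_inv_word: "w \<in> group_words A \<Longrightarrow> disp (inv_word w) = disp w"
  using dist_act_left[of "val w" b b] by (simp add: disp_def val_inv_word dist_commute)

lemma dist_act_val_append:
  "u \<in> group_words A \<Longrightarrow> v \<in> group_words A \<Longrightarrow> dist (act (val u) b) (act (val (u @ v)) b) = disp v"
  by (simp add: disp_def val_append act_mult)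

text \<open>
  The three points \<open>b\<close>, \<open>u\<^sup>-\<^sup>1 b\<close> and \<open>u\<^sup>-\<^sup>1 z u b\<close> lie on the orbit path of the reduced word
  \<open>u\<^sup>-\<^sup>1 z u\<close>, so the Gromov product of the outer two seen from \<open>u\<^sup>-\<^sup>1 b\<close> is bounded.  Hence the
  displacement of \<open>u\<^sup>-\<^sup>1 z u\<close> is, up to a constant, the sum of the displacements of \<open>u\<^sup>-\<^sup>1\<close> and of \<open>z u\<close>,
  and each of them is that of \<open>u\<close> up to a constant.
\<close>

theorem conj_word_displacement:
  assumes cat: "CAT_minus_one TYPE('x)" and pd: "properly_discontinuous G act"
    and cc: "convex_cocompact G act b"
  shows "\<exists>K. \<forall>u z. u \<in> group_words A \<longrightarrow> z \<in> group_words A \<longrightarrow> length z = k \<longrightarrow>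
            reduced_word (conj_word u z) \<longrightarrow> \<bar>disp (conj_word u z) - 2 * disp u\<bar> \<le> K"
proof -
  interpret hyperbolic_geodesic "TYPE('x)" "arcosh 2"
    using cat by (rule CAT_minus_one_hyperbolic_geodesic)
  obtain a C where a: "a > 0" "C \<ge> 0"
    and low: "\<And>g. g \<in> carrier G \<Longrightarrow> a * real (len g) - C \<le> dist b (act g b)"
    using svarc_milnor_lower_bound[OF geodesic pd cc, of len] len_mult_le by blast
  obtain B where B: "\<And>n f m. quasi_geodesic letter_disp_bound a C n f \<Longrightarrow> m \<le> n \<Longrightarrow>
      gromov_product (f m) (f 0) (f n) \<le> B"
    using quasi_geodesic_gromov_product_bounded[OF letter_disp_bound_nonneg a] by blast
  show ?thesis
  proof (intro exI[of _ "letter_disp_bound * real k + 2 * \<bar>B\<bar>"] allI impI)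
    fix u z assume u: "u \<in> group_words A" and z: "z \<in> group_words A" "length z = k"
      and red: "reduced_word (conj_word u z)"
    define w where "w = conj_word u z"
    have w: "w \<in> group_words A" "reduced_word w" using u z red by (auto simp: w_def)
    define f where "f i = act (val (take i w)) b" for i
    have split: "\<exists>s. s \<in> group_words A \<and> reduced_word s \<and> length s = j - i \<and> dist (f i) (f j) = disp s"
      if "i \<le> j" "j \<le> length w" for i j
    proof -
      define s where "s = drop i (take j w)"
      have tj: "take j w = take i w @ s"
        using that by (metis append_take_drop_id min.absorb1 s_def take_take)
      have "w = take i w @ s @ drop j w" using tj by (metis append.assoc append_take_drop_id)
      then have "take i w \<in> group_words A \<and> s \<in> group_words A \<and> reduced_word s"
        using w by (metis group_words_append reduced_word_append)
      moreover from this have "dist (f i) (f j) = disp s"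
        unfolding f_def tj by (intro dist_act_val_append) auto
      moreover have "length s = j - i" using that by (simp add: s_def)
      ultimately show ?thesis by blast
    qed
    have "quasi_geodesic letter_disp_bound a C (length w) f"
      unfolding quasi_geodesic_def
    proof (intro conjI allI impI)
      fix i assume "i < length w"
      then obtain s where s: "s \<in> group_words A" "length s = Suc i - i" "dist (f i) (f (Suc i)) = disp s"
        using split[of i "Suc i"] by auto
      then show "dist (f i) (f (Suc i)) \<le> letter_disp_bound" using disp_le[of s] by simp
    next
      have main: "a * \<bar>real i - real j\<bar> - C \<le> dist (f i) (f j)" if ij: "i \<le> j" "j \<le> length w" for i j
      proof -
        obtain s where s: "s \<in> group_words A" "reduced_word s" "length s = j - i" "dist (f i) (f j) = disp s"
          using split[OF ij] by blast
        then have "a * real (j - i) - C \<le> disp s" using low[of "val s"] by (simp add: len_val disp_def)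
        then show ?thesis using s ij by (simp add: of_nat_diff)
      qed
      fix i j assume "i \<le> length w" "j \<le> length w"
      then show "a * \<bar>real i - real j\<bar> - C \<le> dist (f i) (f j)"
        using main[of i j] main[of j i] by (cases "i \<le> j") (auto simp: dist_commute abs_minus_commute)
    qed
    moreover have m: "length u \<le> length w" by (simp add: w_def)
    ultimately have gp: "gromov_product (f (length u)) (f 0) (f (length w)) \<le> B" by (rule B)
    have w': "w = inv_word u @ z @ u" by (simp add: w_def conj_word_def)
    have f: "f 0 = b" "f (length u) = act (val (inv_word u)) b" "f (length w) = act (val w) b"
      by (simp_all add: f_def w')
    have d1: "dist (f (length u)) (f 0) = disp u"
      using disp_inv_word[OF u] by (simp add: f disp_def dist_commute)
    have d2: "dist (f (length u)) (f (length w)) = disp (z @ u)"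
      unfolding f(2,3) using u z by (subst w', intro dist_act_val_append) auto
    have "\<bar>disp (z @ u) - disp u\<bar> \<le> disp z"
      using dist_act_mult_le[of "val z" "val u"] u z by (simp add: disp_def val_append)
    then have d3: "\<bar>disp (z @ u) - disp u\<bar> \<le> letter_disp_bound * real k" using disp_le[OF z(1)] z by simp
    have d4: "dist (f 0) (f (length w)) = disp w" by (simp add: f disp_def)
    have "disp w \<le> disp u + disp (z @ u)"
      using dist_triangle[of "f 0" "f (length w)" "f (length u)"] by (simp add: d1 d2 d4 dist_commute[of "f 0" "f (length u)"])
    moreover have "disp u + disp (z @ u) - disp w \<le> 2 * B"
      using gp by (simp add: gromov_product_def d1 d2 d4)
    ultimately show "\<bar>disp (conj_word u z) - 2 * disp u\<bar> \<le> letter_disp_bound * real k + 2 * \<bar>B\<bar>"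
      using d3 unfolding w_def[symmetric] by linarith
  qed
qed

end

section \<open>Equidistribution over the first letter\<close>

lemma norm_iexp_diff_le: "norm (iexp x - iexp y) \<le> \<bar>x - y\<bar>"
proof -
  have "iexp x - iexp y = iexp y * (iexp (x - y) - 1)"
    by (simp add: algebra_simps flip: exp_add)
  then have "norm (iexp x - iexp y) = norm (iexp (x - y) - 1)"
    by (simp add: norm_mult)
  also have "\<dots> \<le> \<bar>x - y\<bar>" using iexp_approx1[of "x - y" 0] by simp
  finally show ?thesis .
qed

lemma contraction_tendsto_zero:
  fixes M \<eta> :: "nat \<Rightarrow> real"
  assumes M: "\<And>n. 0 \<le> M n" and c: "0 \<le> c" "c < 1"
    and rec: "eventually (\<lambda>n. M (Suc n) \<le> c * M n + \<eta> n) sequentially" and \<eta>: "\<eta> \<longlonglongrightarrow> 0"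
  shows "M \<longlonglongrightarrow> 0"
proof (rule LIMSEQ_I)
  fix r :: real assume r: "r > 0"
  have "eventually (\<lambda>n. \<eta> n < (1 - c) * (r / 2)) sequentially"
    using \<eta> r c by (intro order_tendstoD(2)[OF \<eta>]) auto
  with rec have "eventually (\<lambda>n. M (Suc n) \<le> c * M n + (1 - c) * (r / 2)) sequentially"
    by eventually_elim linarith
  then obtain N where N: "\<And>n. n \<ge> N \<Longrightarrow> M (Suc n) \<le> c * M n + (1 - c) * (r / 2)"
    by (auto simp: eventually_sequentially)
  have le: "M (N + j) \<le> c ^ j * M N + r / 2" for j
  proof (induction j)
    case (Suc j)
    have "M (N + Suc j) \<le> c * M (N + j) + (1 - c) * (r / 2)" using N[of "N + j"] by simp
    also have "\<dots> \<le> c * (c ^ j * M N + r / 2) + (1 - c) * (r / 2)"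
      using Suc c by (intro add_right_mono mult_left_mono)
    finally show ?case by (simp add: field_simps)
  qed (use r in simp)
  have "(\<lambda>j. c ^ j * M N) \<longlonglongrightarrow> 0"
    using c by (intro tendsto_mult_left_zero LIMSEQ_power_zero) auto
  then have "eventually (\<lambda>j. c ^ j * M N < r / 2) sequentially"
    using r by (intro order_tendstoD(2)) auto
  then obtain J where J: "\<And>j. j \<ge> J \<Longrightarrow> c ^ j * M N < r / 2" by (auto simp: eventually_sequentially)
  show "\<exists>n0. \<forall>n\<ge>n0. norm (M n - 0) < r"
  proof (intro exI[of _ "N + J"] allI impI)
    fix n assume "N + J \<le> n"
    then have "M n \<le> c ^ (n - N) * M N + r / 2" "c ^ (n - N) * M N < r / 2"
      using le[of "n - N"] J[of "n - N"] by auto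
    then show "norm (M n - 0) < r" using M[of n] by simp
  qed
qed

lemma sum_words:
  assumes "finite A" "n > 0"
  shows "(\<Sum>w | w \<in> group_words A \<and> reduced_word w \<and> length w = n. f w) =
         (\<Sum>l\<in>A \<times> UNIV. \<Sum>w\<in>words_from A l n. f w)"
proof -
  have "{w. w \<in> group_words A \<and> reduced_word w \<and> length w = n} = (\<Union>l\<in>A \<times> UNIV. words_from A l n)"
    using assms(2) by (auto simp: words_from_def group_words_def in_lists_conv_set intro!: hd_in_set)
  then show ?thesis
    using assms by (simp add: sum.UNION_disjoint finite_words_from words_from_disjoint)
qed

text \<open>
  The contraction argument.  \<open>F\<close> stands for the displacement; it is enough that adding a letter in
  front changes it by a bounded amount and that it grows at most linearly.
\<close>

theorem char_given_first_letter:
  fixes F :: "('g \<times> bool) list \<Rightarrow> real" and lam t D :: real and \<phi> :: complex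
  assumes A: "finite A" "card A \<ge> 2"
    and D: "\<And>l v. l \<in> A \<times> UNIV \<Longrightarrow> v \<in> group_words A \<Longrightarrow> \<bar>F (l # v) - F v\<bar> \<le> D"
    and F: "\<And>v. v \<in> group_words A \<Longrightarrow> \<bar>F v\<bar> \<le> D * real (length v)"
    and lim: "(\<lambda>n. (\<Sum>w | w \<in> group_words A \<and> reduced_word w \<and> length w = n.
                   iexp (t * ((F w - lam * real n) / sqrt (real n)))) /
                 card {w. w \<in> group_words A \<and> reduced_word w \<and> length w = n}) \<longlonglongrightarrow> \<phi>"
    and l: "l \<in> A \<times> UNIV"
  shows "(\<lambda>n. (\<Sum>w\<in>words_from A l n. iexp (t * ((F w - lam * real n) / sqrt (real n)))) /
            card (words_from A l n)) \<longlonglongrightarrow> \<phi>"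
proof -
  define X where "X n w = (F w - lam * real n) / sqrt (real n)" for n w
  define q where "q = 2 * card A - 1"
  define a where "a l n = (\<Sum>w\<in>words_from A l n. iexp (t * X n w)) / card (words_from A l n)" for l n
  \<comment> \<open>bounds the change of the normalised value when a letter is put in front of a word of length \<open>n\<close>:
     the first term comes from the numerator, the second from the denominator\<close>
  define \<epsilon> where "\<epsilon> n = (D + \<bar>lam\<bar>) / sqrt (real n + 1) +
      (D + \<bar>lam\<bar>) * real n * (1 / sqrt (real n) - 1 / sqrt (real n + 1))" for n
  define T where "T n = (\<Sum>l\<in>A \<times> UNIV. a l n) - (of_nat q + 1) * \<phi>" for n
  have q: "q \<ge> 3" "2 * card A = Suc q" using A by (auto simp: q_def)
  have fin: "finite (A \<times> (UNIV :: bool set))" using A by simp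
  have cardwf: "card (words_from A l n) = q ^ (n - 1)" if "l \<in> A \<times> UNIV" "n > 0" for l n
    using card_words_from[OF A(1) that(1), of "n - 1"] that by (simp add: q_def)
  have step: "norm (a l (Suc n) - (\<Sum>l'\<in>A \<times> UNIV - {inv_letter l}. a l' n) / q) \<le> \<bar>t\<bar> * \<epsilon> n"
    if l: "l \<in> A \<times> UNIV" and n: "n > 0" for l n
  proof -
    let ?L = "A \<times> UNIV - {inv_letter l}"
    have qn: "q ^ n = q * q ^ (n - 1)" using n by (cases n) auto
    have cardL: "card ?L = q" 
      using card_Diff_singleton[of "inv_letter l" "A \<times> UNIV"] l card_letters[OF A(1)]
      by (simp add: q_def del: card_Diff_singleton card_cartesian_product)
    have Xl: "\<bar>X (Suc n) (l # v) - X n v\<bar> \<le> \<epsilon> n" if v: "v \<in> words_from A l' n" for l' v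
    proof -
      have v: "v \<in> group_words A" "length v = n" using v by (auto simp: words_from_def)
      have "X (Suc n) (l # v) - X n v = (F (l # v) - F v - lam) / sqrt (real n + 1) +
         (lam * real n - F v) * (1 / sqrt (real n) - 1 / sqrt (real n + 1))"
        by (simp add: X_def diff_divide_distrib add_divide_distrib algebra_simps)
      also have "\<bar>\<dots>\<bar> \<le> \<bar>F (l # v) - F v - lam\<bar> / sqrt (real n + 1) +
         \<bar>lam * real n - F v\<bar> * (1 / sqrt (real n) - 1 / sqrt (real n + 1))"
      proof -
        have "1 / sqrt (real n) - 1 / sqrt (real n + 1) \<ge> 0"
          using n by (simp add: field_simps)
        then show ?thesis by (intro order.trans[OF abs_triangle_ineq]) (simp add: abs_mult)
      qed
      also have "\<dots> \<le> \<epsilon> n"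
        unfolding \<epsilon>_def
      proof (intro add_mono divide_right_mono mult_right_mono)
        show "\<bar>F (l # v) - F v - lam\<bar> \<le> D + \<bar>lam\<bar>" using D[OF l v(1)] by linarith
        have "\<bar>F v\<bar> \<le> D * real n" using F[OF v(1)] v(2) by simp
        then have "\<bar>lam * real n - F v\<bar> \<le> \<bar>lam * real n\<bar> + D * real n" by linarith
        then show "\<bar>lam * real n - F v\<bar> \<le> (D + \<bar>lam\<bar>) * real n"
          by (simp add: abs_mult algebra_simps)
        show "0 \<le> 1 / sqrt (real n) - 1 / sqrt (real n + 1)" using n by (simp add: field_simps)
      qed auto
      finally show ?thesis .
    qed
    have "a l (Suc n) = (\<Sum>l'\<in>?L. \<Sum>v\<in>words_from A l' n. iexp (t * X (Suc n) (l # v))) / q ^ n"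
      unfolding a_def sum_words_from_Suc[OF A(1) l n] by (simp add: cardwf[OF l])
    moreover have "(\<Sum>l'\<in>?L. a l' n) / q = (\<Sum>l'\<in>?L. \<Sum>v\<in>words_from A l' n. iexp (t * X n v)) / q ^ n"
    proof -
      have "(\<Sum>l'\<in>?L. a l' n) = (\<Sum>l'\<in>?L. (\<Sum>v\<in>words_from A l' n. iexp (t * X n v)) / of_nat (q ^ (n - 1)))"
        by (intro sum.cong refl) (simp add: a_def cardwf n)
      then show ?thesis by (simp add: qn flip: sum_divide_distrib)
    qed
    ultimately have "a l (Suc n) - (\<Sum>l'\<in>?L. a l' n) / q =
      (\<Sum>l'\<in>?L. \<Sum>v\<in>words_from A l' n. iexp (t * X (Suc n) (l # v)) - iexp (t * X n v)) / q ^ n"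
      by (simp add: sum_subtractf diff_divide_distrib)
    also have "norm \<dots> \<le> (\<Sum>l'\<in>?L. \<Sum>v\<in>words_from A l' n. \<bar>t\<bar> * \<epsilon> n) / q ^ n"
      unfolding norm_divide norm_power norm_of_nat
    proof (intro divide_right_mono sum_norm_le)
      fix l' v assume "v \<in> words_from A l' n"
      have "norm (iexp (t * X (Suc n) (l # v)) - iexp (t * X n v)) \<le> \<bar>t * X (Suc n) (l # v) - t * X n v\<bar>"
        by (rule norm_iexp_diff_le)
      also have "\<dots> = \<bar>t\<bar> * \<bar>X (Suc n) (l # v) - X n v\<bar>"
        by (simp flip: abs_mult add: right_diff_distrib)
      also have "\<dots> \<le> \<bar>t\<bar> * \<epsilon> n" using Xl[OF \<open>v \<in> words_from A l' n\<close>] by (intro mult_left_mono) auto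
      finally show "norm (iexp (t * X (Suc n) (l # v)) - iexp (t * X n v)) \<le> \<bar>t\<bar> * \<epsilon> n" .
    qed auto
    also have "\<dots> = \<bar>t\<bar> * \<epsilon> n"
    proof -
      have "(\<Sum>l'\<in>?L. \<Sum>v\<in>words_from A l' n. \<bar>t\<bar> * \<epsilon> n) = real (q * q ^ (n - 1)) * (\<bar>t\<bar> * \<epsilon> n)"
        by (simp add: cardwf n cardL)
      then show ?thesis using q by (simp add: qn)
    qed
    finally show ?thesis .
  qed
  have T0: "T \<longlonglongrightarrow> 0"
  proof -
    have "(\<lambda>n. (of_nat q + 1) * ((\<Sum>w | w \<in> group_words A \<and> reduced_word w \<and> length w = n.
                   iexp (t * X n w)) /
                 card {w. w \<in> group_words A \<and> reduced_word w \<and> length w = n}) - (of_nat q + 1) * \<phi>)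
           \<longlonglongrightarrow> (of_nat q + 1) * \<phi> - (of_nat q + 1) * \<phi>"
      using lim unfolding X_def[symmetric] by (intro tendsto_intros)
    moreover have "eventually (\<lambda>n. (of_nat q + 1) * ((\<Sum>w | w \<in> group_words A \<and> reduced_word w \<and> length w = n.
                   iexp (t * X n w)) /
                 card {w. w \<in> group_words A \<and> reduced_word w \<and> length w = n}) - (of_nat q + 1) * \<phi> = T n) sequentially"
      using eventually_gt_at_top[of 0]
    proof eventually_elim
      case (elim n)
      have "card {w. w \<in> group_words A \<and> reduced_word w \<and> length w = n} = (\<Sum>l\<in>A \<times> (UNIV :: bool set). q ^ (n - 1))"
        using sum_words[OF A(1) elim, of "\<lambda>_. 1 :: nat"] by (simp add: cardwf elim)
      also have "\<dots> = (q + 1) * q ^ (n - 1)" 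
        using card_letters[OF A(1)] q(2) by (simp del: card_cartesian_product)
      finally have c: "card {w. w \<in> group_words A \<and> reduced_word w \<and> length w = n} = (q + 1) * q ^ (n - 1)" .
      have "(\<Sum>l\<in>A \<times> UNIV. a l n) = (\<Sum>l\<in>A \<times> UNIV. \<Sum>w\<in>words_from A l n. iexp (t * X n w)) / of_nat (q ^ (n - 1))"
        unfolding a_def sum_divide_distrib by (intro sum.cong refl) (simp add: cardwf elim)
      moreover have "(of_nat q + 1) * (s / of_nat ((q + 1) * Q)) = s / of_nat Q" for s :: complex and Q :: nat
      proof -
        have "(of_nat q + 1 :: complex) \<noteq> 0" by (metis of_nat_Suc of_nat_neq_0 add.commute)
        moreover have "of_nat ((q + 1) * Q) = (of_nat q + 1) * (of_nat Q :: complex)"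
          by (simp add: algebra_simps)
        ultimately show ?thesis by (simp only: times_divide_eq_right nonzero_mult_divide_mult_cancel_left not_False_eq_True)
      qed
      ultimately show ?case
        unfolding T_def c sum_words[OF A(1) elim] by (simp only:)
    qed
    ultimately show ?thesis by (simp add: tendsto_cong)
  qed
  have \<epsilon>0: "\<epsilon> \<longlonglongrightarrow> 0" unfolding \<epsilon>_def by real_asymp
  define M where "M n = (\<Sum>l\<in>A \<times> UNIV. norm (a l n - \<phi>))" for n
  define \<eta> where "\<eta> n = (real q + 1) * (norm (T n) / q + \<bar>t\<bar> * \<epsilon> n)" for n
  have "M \<longlonglongrightarrow> 0"
  proof (rule contraction_tendsto_zero[where c = "1 / q" and \<eta> = \<eta>])
    show "0 \<le> M n" for n unfolding M_def by (intro sum_nonneg) auto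
    have "\<eta> \<longlonglongrightarrow> (real q + 1) * (norm (0 :: complex) / q + \<bar>t\<bar> * 0)"
      unfolding \<eta>_def by (intro tendsto_intros T0 \<epsilon>0) (use q in auto)
    then show "\<eta> \<longlonglongrightarrow> 0" by simp
    show "eventually (\<lambda>n. M (Suc n) \<le> 1 / q * M n + \<eta> n) sequentially"
      using eventually_gt_at_top[of 0]
    proof eventually_elim
      case (elim n)
      have "M (Suc n) \<le> (\<Sum>l\<in>A \<times> UNIV. norm (a (inv_letter l) n - \<phi>) / q + (norm (T n) / q + \<bar>t\<bar> * \<epsilon> n))"
        unfolding M_def
      proof (rule sum_mono)
        fix l assume l: "l \<in> A \<times> (UNIV :: bool set)"
        have il: "inv_letter l \<in> A \<times> UNIV" using l by simp
        have "(\<Sum>l'\<in>A \<times> UNIV - {inv_letter l}. a l' n) = T n + (of_nat q + 1) * \<phi> - a (inv_letter l) n"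
          using sum.remove[OF fin il, of "\<lambda>l. a l n"] by (simp add: T_def)
        then have "(\<Sum>l'\<in>A \<times> UNIV - {inv_letter l}. a l' n) / q =
            \<phi> + (T n - (a (inv_letter l) n - \<phi>)) / q"
          using q by (simp only:) (simp add: field_simps)
        then have "a l (Suc n) - \<phi> = (a l (Suc n) - (\<Sum>l'\<in>A \<times> UNIV - {inv_letter l}. a l' n) / q)
           + (T n - (a (inv_letter l) n - \<phi>)) / q"
          by simp
        also have "norm \<dots> \<le> \<bar>t\<bar> * \<epsilon> n + (norm (T n) + norm (a (inv_letter l) n - \<phi>)) / q"
          by (intro order.trans[OF norm_triangle_ineq] add_mono step l elim)
             (auto simp: norm_divide intro!: divide_right_mono norm_triangle_ineq4)
        finally show "norm (a l (Suc n) - \<phi>) \<le> norm (a (inv_letter l) n - \<phi>) / q + (norm (T n) / q + \<bar>t\<bar> * \<epsilon> n)"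
          by (simp add: add_divide_distrib)
      qed
      also have "\<dots> = (\<Sum>l\<in>A \<times> UNIV. norm (a (inv_letter l) n - \<phi>)) / q + \<eta> n"
        using card_letters[OF A(1)] q(2)
        by (simp add: sum.distrib sum_divide_distrib \<eta>_def distrib_left add_ac del: card_cartesian_product)
      also have "(\<Sum>l\<in>A \<times> UNIV. norm (a (inv_letter l) n - \<phi>)) = M n"
        unfolding M_def
        by (rule sum.reindex_bij_witness[of _ inv_letter inv_letter]) auto
      finally show ?case by simp
    qed
  qed (use q in auto)
  moreover have "eventually (\<lambda>n. norm (a l n - \<phi>) \<le> M n) sequentially"
    unfolding M_def
    by (intro always_eventually allI member_le_sum[OF l, of "\<lambda>l. norm (a l _ - \<phi>)"] fin) auto
  ultimately have "(\<lambda>n. a l n - \<phi>) \<longlonglongrightarrow> 0" by (rule Lim_null_comparison[rotated])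
  then have "(\<lambda>n. a l n) \<longlonglongrightarrow> \<phi>" by (simp add: LIM_zero_iff)
  then show ?thesis unfolding a_def X_def .
qed

section \<open>The central limit theorem\<close>

lemma real_distribution_uniform:
  assumes "finite F" "F \<noteq> {}"
  shows "real_distribution (distr (uniform_count_measure F) borel X)"
proof -
  interpret prob_space "uniform_count_measure F" using assms by (rule prob_space_uniform_count_measure)
  show ?thesis by (rule real_distribution_distr) (simp add: measurable_def sets_uniform_count_measure space_uniform_count_measure)
qed

lemma char_uniform:
  assumes "finite F"
  shows "char (distr (uniform_count_measure F) borel X) t = (\<Sum>x\<in>F. iexp (t * X x)) / card F"
proof -
  have X: "X \<in> borel_measurable (uniform_count_measure F)"
    by (simp add: measurable_def sets_uniform_count_measure space_uniform_count_measure)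
  have "char (distr (uniform_count_measure F) borel X) t = (CLINT x|uniform_count_measure F. iexp (t * X x))"
    unfolding char_def by (subst integral_distr[OF X]) auto
  also have "\<dots> = (\<Sum>x\<in>F. (1 / real (card F)) *\<^sub>R iexp (t * X x))"
    using assms unfolding uniform_count_measure_def by (subst lebesgue_integral_point_measure_finite) auto
  finally show ?thesis by (simp add: scaleR_conv_of_real sum_divide_distrib)
qed

lemma measure_uniform:
  assumes "finite F" "S \<in> sets borel"
  shows "measure (distr (uniform_count_measure F) borel X) S = real (card {x\<in>F. X x \<in> S}) / card F"
proof -
  have "measure (distr (uniform_count_measure F) borel X) S =
        measure (uniform_count_measure F) (X -` S \<inter> F)"
    using assms(2) by (subst measure_distr) (auto simp: measurable_def sets_uniform_count_measure space_uniform_count_measure)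
  also have "\<dots> = real (card (X -` S \<inter> F)) / card F"
    using assms(1) by (simp add: measure_uniform_count_measure)
  also have "X -` S \<inter> F = {x\<in>F. X x \<in> S}" by auto
  finally show ?thesis .
qed

lemma real_distribution_normal:
  "\<sigma> > 0 \<Longrightarrow> real_distribution (density lborel (normal_density 0 \<sigma>))"
  by (simp add: real_distribution_def real_distribution_axioms_def prob_space_normal_density)

lemma char_normal_scale:
  assumes "\<sigma> > 0" "\<alpha> > 0"
  shows "char (density lborel (normal_density 0 (\<alpha> * \<sigma>))) t = char (density lborel (normal_density 0 \<sigma>)) (\<alpha> * t)"
proof -
  interpret prob_space "density lborel (normal_density 0 \<sigma>)" using assms(1) by (rule prob_space_normal_density)
  have "distributed (density lborel (normal_density 0 \<sigma>)) lborel (\<lambda>x. x) (normal_density 0 \<sigma>)"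
    by (simp add: distributed_def distr_id2)
  from normal_density_affine[OF this assms(1), of \<alpha> 0] assms(2)
  have "distr (density lborel (normal_density 0 \<sigma>)) lborel (\<lambda>x. \<alpha> * x) = density lborel (normal_density 0 (\<alpha> * \<sigma>))"
    by (simp add: distributed_def)
  then have "char (density lborel (normal_density 0 (\<alpha> * \<sigma>))) t =
      (CLINT x|distr (density lborel (normal_density 0 \<sigma>)) lborel (\<lambda>x. \<alpha> * x). iexp (t * x))"
    by (simp add: char_def)
  also have "\<dots> = char (density lborel (normal_density 0 \<sigma>)) (\<alpha> * t)"
    unfolding char_def by (subst integral_distr) (auto simp: mult_ac)
  finally show ?thesis .
qed

lemma measure_normal_lessThan:
  assumes "\<sigma> > 0"
  shows "measure (density lborel (normal_density 0 \<sigma>)) {..<y} =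
           1 / (sqrt (2 * pi) * \<sigma>) * (LINT t:{..y}|lborel. exp (- (t\<^sup>2 / (2 * \<sigma>\<^sup>2))))"
    and "emeasure (density lborel (normal_density 0 \<sigma>)) {y} = 0"
proof -
  interpret prob_space "density lborel (normal_density 0 \<sigma>)" using assms by (rule prob_space_normal_density)
  have "measure (density lborel (normal_density 0 \<sigma>)) {..<y} =
        (LINT x|density lborel (normal_density 0 \<sigma>). indicator {..<y} x)"
    by simp
  also have "\<dots> = (LINT x|lborel. normal_density 0 \<sigma> x * indicator {..<y} x)"
    by (subst integral_density) (auto simp: normal_density_nonneg)
  also have "\<dots> = (LINT x|lborel. 1 / (sqrt (2 * pi) * \<sigma>) * (indicator {..y} x * exp (- (x\<^sup>2 / (2 * \<sigma>\<^sup>2)))))"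
  proof (rule integral_cong_AE)
    show "AE x in lborel. normal_density 0 \<sigma> x * indicator {..<y} x =
        1 / (sqrt (2 * pi) * \<sigma>) * (indicator {..y} x * exp (- (x\<^sup>2 / (2 * \<sigma>\<^sup>2))))"
      using AE_lborel_singleton[of y]
      by eventually_elim (use assms in \<open>auto simp: normal_density_def indicator_def real_sqrt_mult\<close>)
  qed simp_all
  also have "\<dots> = 1 / (sqrt (2 * pi) * \<sigma>) * (LINT t:{..y}|lborel. exp (- (t\<^sup>2 / (2 * \<sigma>\<^sup>2))))"
    by (simp add: set_lebesgue_integral_def)
  finally show "measure (density lborel (normal_density 0 \<sigma>)) {..<y} =
           1 / (sqrt (2 * pi) * \<sigma>) * (LINT t:{..y}|lborel. exp (- (t\<^sup>2 / (2 * \<sigma>\<^sup>2))))" .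
  have "AE x in lborel. x \<in> {y} \<longrightarrow> ennreal (normal_density 0 \<sigma> x) = 0"
    using AE_lborel_singleton[of y] by eventually_elim simp
  then have "{y} \<in> null_sets (density lborel (normal_density 0 \<sigma>))"
    by (subst null_sets_density_iff) auto
  then show "emeasure (density lborel (normal_density 0 \<sigma>)) {y} = 0" by auto
qed

context free_isometric_action
begin

lemma finite_words: "finite {w \<in> group_words A. reduced_word w \<and> length w = n}"
  unfolding group_words_def lists_eq_set
  by (rule finite_subset[OF _ finite_lists_length_eq[of "A \<times> UNIV" n]]) (use finite_A in auto)

lemma char_word_sphere:
  "char (displacement_distr act b lam (word_sphere G A n) n) t =
     (\<Sum>w | w \<in> group_words A \<and> reduced_word w \<and> length w = n.
         iexp (t * ((disp w - lam * real n) / sqrt (real n)))) /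
       card {w. w \<in> group_words A \<and> reduced_word w \<and> length w = n}"
proof -
  have inj: "inj_on val {w. w \<in> group_words A \<and> reduced_word w \<and> length w = n}"
    by (rule inj_on_subset[OF inj_on_val]) auto
  show ?thesis
    unfolding displacement_distr_def word_sphere_eq
    using finite_words[of n] by (simp add: char_uniform sum.reindex[OF inj] card_image[OF inj] disp_def)
qed

lemma card_words_from_pos:
  assumes "card A \<ge> 2" "l \<in> A \<times> UNIV" "n > 0"
  shows "card (words_from A l n) > 0"
  using card_words_from[OF finite_A assms(2), of "n - 1"] assms by simp

lemma finite_nonempty_word_sphere:
  assumes "card A \<ge> 2"
  shows "finite (word_sphere G A n)" "word_sphere G A n \<noteq> {}"
proof -
  show "finite (word_sphere G A n)" unfolding word_sphere_eq using finite_words by simp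
  obtain x where x: "x \<in> A" using assms by fastforce
  have "{w \<in> group_words A. reduced_word w \<and> length w = n} \<noteq> {}"
  proof (cases "n = 0")
    case False
    then have "words_from A (x, True) n \<noteq> {}"
      using card_words_from_pos[OF assms, of "(x, True)" n] x by fastforce
    then show ?thesis by (auto simp: words_from_def)
  qed (auto intro!: exI[of _ "[]"])
  then show "word_sphere G A n \<noteq> {}" unfolding word_sphere_eq by blast
qed

text \<open>
  The words \<open>u\<close> that fit around \<open>z\<close> are described by their first letter alone, which reduces averages
  over a sphere of the conjugacy class to averages over words with given first letter.
\<close>

lemma reduced_conj_words_eq:
  assumes "\<And>z. z \<in> Z \<Longrightarrow> z \<in> group_words A \<and> cyclically_reduced z \<and> z \<noteq> []" "m > 0"
  shows "{(z, u). z \<in> Z \<and> u \<in> group_words A \<and> length u = m \<and> reduced_word (conj_word u z)} =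
         (SIGMA z:Z. \<Union>l\<in>A \<times> UNIV - {hd z, inv_letter (last z)}. words_from A l m)"
proof -
  have "(z, u) \<in> {(z, u). z \<in> Z \<and> u \<in> group_words A \<and> length u = m \<and> reduced_word (conj_word u z)} \<longleftrightarrow>
     (z, u) \<in> (SIGMA z:Z. \<Union>l\<in>A \<times> UNIV - {hd z, inv_letter (last z)}. words_from A l m)" for z u
  proof (cases "z \<in> Z \<and> u \<in> group_words A \<and> length u = m")
    case True
    then have "u \<noteq> []" "hd u \<in> A \<times> UNIV" 
      using assms(2) by (auto simp: group_words_def in_lists_conv_set)
    then show ?thesis using True assms(1)[of z]
      by (auto simp: reduced_conj_word words_from_def cyclically_reduced_def)
  qed (auto simp: words_from_def)
  then show ?thesis by auto
qed

text \<open>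
  Every block of words \<open>u\<close> belonging to a pair of \<open>z\<close> and an admissible first letter has the same
  number of elements, so the characteristic function on the sphere is the plain mean of the block
  averages, and each of these converges to the same limit.
\<close>

theorem conjugacy_class_clt:
  assumes p: "card A \<ge> 2" and cat: "CAT_minus_one TYPE('x)" and pd: "properly_discontinuous G act"
    and cc: "convex_cocompact G act b" and \<sigma>: "\<sigma> > 0"
    and clt: "weak_conv_m (\<lambda>n. displacement_distr act b lam (word_sphere G A n) n)
           (density lborel (normal_density 0 \<sigma>))"
    and C: "C \<in> conjugacy_classes G" "C \<noteq> {\<one>}" and k: "k = (LEAST n. \<exists>x\<in>C. len x = n)"
  shows "finite (C \<inter> word_sphere G A (k + 2 * m))" "C \<inter> word_sphere G A (k + 2 * m) \<noteq> {}"
    and "weak_conv_m (\<lambda>m. displacement_distr act b lam (C \<inter> word_sphere G A (k + 2 * m)) (k + 2 * m))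
           (density lborel (normal_density 0 (sqrt 2 * \<sigma>)))"
proof -
  define Z where "Z = cyclic_reps C"
  define J where "J m = {(z, u). z \<in> Z \<and> u \<in> group_words A \<and> length u = m \<and> reduced_word (conj_word u z)}" for m
  define S where "S m = C \<inter> word_sphere G A (k + 2 * m)" for m
  define L where "L z = A \<times> UNIV - {hd z, inv_letter (last z)}" for z :: "('a \<times> bool) list"
  define N where "N = (\<Sum>z\<in>Z. card (L z))"
  define q where "q = 2 * card A - 1"
  have Zk: "z \<in> group_words A" "cyclically_reduced z" "length z = k" if "z \<in> Z" for z
    using that conjugacy_class_sphere(2)[OF C k] by (auto simp: Z_def cyclic_reps_def)
  have k0: "k > 0" using conjugacy_class_sphere(1)[OF C k] .
  have bij: "bij_betw (\<lambda>(z, u). val (conj_word u z)) (J m) (S m)" for m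
    unfolding J_def S_def Z_def by (rule conjugacy_class_sphere(3)[OF C k])
  have "Z \<subseteq> {w \<in> group_words A. reduced_word w \<and> length w = k}"
    using Zk by (auto simp: cyclically_reduced_def)
  then have finZ: "finite Z" using finite_words finite_subset by blast
  obtain z0 where z0: "z0 \<in> Z" using ex_cyclic_rep[OF C(1)] by (auto simp: Z_def)
  have finL: "finite (L z)" for z using finite_A by (simp add: L_def)
  \<comment> \<open>two letters are excluded, and there are at least four\<close>
  have cL: "card (L z) > 0" for z
  proof -
    have "2 * card A - card {hd z, inv_letter (last z)} \<le> card (L z)"
      unfolding L_def card_letters[OF finite_A, symmetric] by (rule diff_card_le_card_Diff) simp
    moreover have "card {hd z, inv_letter (last z)} \<le> 2" by (simp add: card_insert_if)
    ultimately show ?thesis using p by linarith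
  qed
  have N: "N > 0" unfolding N_def using finZ z0 cL by (intro sum_pos) auto
  have q: "q > 0" using p by (simp add: q_def)
  have JL: "J m = (SIGMA z:Z. \<Union>l\<in>L z. words_from A l m)" if "m > 0" for m
    unfolding J_def L_def using Zk k0 that by (intro reduced_conj_words_eq) auto
  have sumJ: "sum f (J m) = (\<Sum>z\<in>Z. \<Sum>l\<in>L z. \<Sum>u\<in>words_from A l m. f (z, u))"
    if "m > 0" for m and f :: "_ \<Rightarrow> 'c::comm_monoid_add"
  proof -
    have "sum f (J m) = (\<Sum>z\<in>Z. \<Sum>u\<in>(\<Union>l\<in>L z. words_from A l m). f (z, u))"
      unfolding JL[OF that] using finZ finL finite_A
      by (subst sum.Sigma) (auto simp: finite_words_from)
    also have "\<dots> = (\<Sum>z\<in>Z. \<Sum>l\<in>L z. \<Sum>u\<in>words_from A l m. f (z, u))"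
      using finL finite_A
      by (intro sum.cong refl sum.UNION_disjoint) (auto simp: finite_words_from words_from_disjoint)
    finally show ?thesis .
  qed
  have cardwf: "card (words_from A l m) = q ^ (m - 1)" if "l \<in> A \<times> UNIV" "m > 0" for l m
    using card_words_from[OF finite_A that(1), of "m - 1"] that by (simp add: q_def)
  have cardJ: "card (J m) = N * q ^ (m - 1)" if "m > 0" for m
  proof -
    have "card (J m) = (\<Sum>z\<in>Z. \<Sum>l\<in>L z. q ^ (m - 1))"
      using sumJ[OF that, of "\<lambda>_. 1 :: nat"] that by (simp add: cardwf L_def)
    then show ?thesis by (simp add: N_def sum_distrib_right)
  qed
  have finS: "finite (S m)" for m
    unfolding S_def using finite_nonempty_word_sphere(1)[OF p] by blast
  have neS: "S m \<noteq> {}" for m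
  proof (cases "m = 0")
    case True
    have "(z0, []) \<in> J m" using z0 Zk[OF z0] by (simp add: J_def True conj_word_def cyclically_reduced_def)
    then show ?thesis using bij[of m] by (auto simp: bij_betw_def)
  next
    case False
    then have "card (S m) > 0" using cardJ[of m] N q bij_betw_same_card[OF bij[of m]] by simp
    then show ?thesis by auto
  qed
  show "finite (C \<inter> word_sphere G A (k + 2 * m))" "C \<inter> word_sphere G A (k + 2 * m) \<noteq> {}"
    using finS neS by (auto simp: S_def)
  obtain K where K: "\<And>u z. u \<in> group_words A \<Longrightarrow> z \<in> group_words A \<Longrightarrow> length z = k \<Longrightarrow>
      reduced_word (conj_word u z) \<Longrightarrow> \<bar>disp (conj_word u z) - 2 * disp u\<bar> \<le> K"
    using conj_word_displacement[OF cat pd cc, of k] by blast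
  define X where "X m u = (disp u - lam * real m) / sqrt (real m)" for m u
  define Y where "Y m z u = (disp (conj_word u z) - lam * real (k + 2 * m)) / sqrt (real (k + 2 * m))" for m z u
  \<comment> \<open>bounds the difference between the normalised displacement of \<open>u\<^sup>-\<^sup>1 z u\<close> and \<open>\<surd>2\<close> times that of \<open>u\<close>\<close>
  define \<epsilon> where "\<epsilon> m = (K + \<bar>lam\<bar> * real k) / sqrt (real k + 2 * real m) +
     2 * (letter_disp_bound + \<bar>lam\<bar>) * real m * (1 / sqrt (2 * real m) - 1 / sqrt (real k + 2 * real m))" for m
  have \<epsilon>0: "\<epsilon> \<longlonglongrightarrow> 0"
  proof -
    define \<kappa> where "\<kappa> = real k"
    have \<kappa>: "\<kappa> > 0" using k0 by (simp add: \<kappa>_def)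
    have "(\<lambda>m. 1 / sqrt (\<kappa> + 2 * real m)) \<longlonglongrightarrow> 0" by real_asymp
    moreover have "(\<lambda>m. real m * (1 / sqrt (2 * real m) - 1 / sqrt (\<kappa> + 2 * real m))) \<longlonglongrightarrow> 0"
      using \<kappa> by real_asymp
    ultimately have "(\<lambda>m. (K + \<bar>lam\<bar> * real k) * (1 / sqrt (\<kappa> + 2 * real m)) +
        2 * (letter_disp_bound + \<bar>lam\<bar>) * (real m * (1 / sqrt (2 * real m) - 1 / sqrt (\<kappa> + 2 * real m))))
        \<longlonglongrightarrow> (K + \<bar>lam\<bar> * real k) * 0 + 2 * (letter_disp_bound + \<bar>lam\<bar>) * 0"
      by (intro tendsto_intros)
    then show ?thesis by (simp add: \<epsilon>_def[abs_def] \<kappa>_def mult.assoc)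
  qed
  have YX: "\<bar>Y m z u - sqrt 2 * X m u\<bar> \<le> \<epsilon> m" if zu: "(z, u) \<in> J m" and m: "m > 0" for z u m
  proof -
    have zu: "z \<in> Z" "u \<in> group_words A" "length u = m" "reduced_word (conj_word u z)"
      using zu by (auto simp: J_def)
    have root: "1 / sqrt (2 * real m) - 1 / sqrt (real k + 2 * real m) \<ge> 0"
      using m by (simp add: frac_le)
    have "sqrt 2 * X m u = 2 * (disp u - lam * real m) / sqrt (2 * real m)"
    proof -
      have "sqrt 2 * (sqrt 2 * sqrt (real m)) = 2 * sqrt (real m)" by simp
      then show ?thesis using m by (simp add: X_def real_sqrt_mult field_simps)
    qed
    then have "Y m z u - sqrt 2 * X m u =
       (disp (conj_word u z) - 2 * disp u - lam * real k) / sqrt (real k + 2 * real m) +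
       2 * (lam * real m - disp u) * (1 / sqrt (2 * real m) - 1 / sqrt (real k + 2 * real m))"
      by (simp add: Y_def diff_divide_distrib add_divide_distrib algebra_simps)
    also have "\<bar>\<dots>\<bar> \<le> \<bar>disp (conj_word u z) - 2 * disp u - lam * real k\<bar> / sqrt (real k + 2 * real m) +
       2 * \<bar>lam * real m - disp u\<bar> * (1 / sqrt (2 * real m) - 1 / sqrt (real k + 2 * real m))"
    proof (rule order.trans[OF abs_triangle_ineq add_mono])
      have "\<bar>2 * x * r\<bar> \<le> 2 * \<bar>x\<bar> * r" if "r \<ge> 0" for x r :: real
        using that by (simp add: abs_mult)
      from this[OF root] show
        "\<bar>2 * (lam * real m - disp u) * (1 / sqrt (2 * real m) - 1 / sqrt (real k + 2 * real m))\<bar>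
          \<le> 2 * \<bar>lam * real m - disp u\<bar> * (1 / sqrt (2 * real m) - 1 / sqrt (real k + 2 * real m))" .
    qed (simp add: abs_divide)
    also have "\<dots> \<le> \<epsilon> m"
      unfolding \<epsilon>_def
    proof (intro add_mono divide_right_mono mult_right_mono root)
      have "\<bar>lam * real k\<bar> = \<bar>lam\<bar> * real k" by (simp add: abs_mult)
      then show "\<bar>disp (conj_word u z) - 2 * disp u - lam * real k\<bar> \<le> K + \<bar>lam\<bar> * real k"
        using K[OF zu(2) Zk(1,3)[OF zu(1)] zu(4)] by linarith
      have "\<bar>lam * real m\<bar> = \<bar>lam\<bar> * real m" by (simp add: abs_mult)
      then have "\<bar>lam * real m - disp u\<bar> \<le> \<bar>lam\<bar> * real m + letter_disp_bound * real m"
        using disp_le[OF zu(2)] zu(3) by (simp add: disp_def abs_le_iff) (smt (verit) zero_le_dist)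
      then show "2 * \<bar>lam * real m - disp u\<bar> \<le> 2 * (letter_disp_bound + \<bar>lam\<bar>) * real m"
        by (simp add: algebra_simps)
    qed simp
    finally show ?thesis .
  qed
  have fl: "(\<lambda>m. (\<Sum>u\<in>words_from A l m. iexp (s * X m u)) / card (words_from A l m)) \<longlonglongrightarrow>
      char (density lborel (normal_density 0 \<sigma>)) s" if "l \<in> A \<times> UNIV" for l s
    unfolding X_def
  proof (rule char_given_first_letter[OF finite_A p _ _ _ that, of disp letter_disp_bound])
    show "\<bar>disp (l # v) - disp v\<bar> \<le> letter_disp_bound" if "l \<in> A \<times> UNIV" "v \<in> group_words A" for l v
      using that by (rule disp_Cons)
    show "\<bar>disp v\<bar> \<le> letter_disp_bound * real (length v)" if "v \<in> group_words A" for v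
      using disp_le[OF that] by (simp add: disp_def)
    show "(\<lambda>n. (\<Sum>w | w \<in> group_words A \<and> reduced_word w \<and> length w = n.
              iexp (s * ((disp w - lam * real n) / sqrt (real n)))) /
            card {w. w \<in> group_words A \<and> reduced_word w \<and> length w = n})
       \<longlonglongrightarrow> char (density lborel (normal_density 0 \<sigma>)) s"
      unfolding char_word_sphere[symmetric]
      by (rule levy_continuity1[OF _ real_distribution_normal[OF \<sigma>] clt])
         (auto simp: displacement_distr_def intro!: real_distribution_uniform finite_nonempty_word_sphere p)
  qed
  show "weak_conv_m (\<lambda>m. displacement_distr act b lam (C \<inter> word_sphere G A (k + 2 * m)) (k + 2 * m))
           (density lborel (normal_density 0 (sqrt 2 * \<sigma>)))"
    unfolding S_def[symmetric]
  proof (rule levy_continuity)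
    show "real_distribution (displacement_distr act b lam (S m) (k + 2 * m))" for m
      unfolding displacement_distr_def using finS neS by (intro real_distribution_uniform)
    show "real_distribution (density lborel (normal_density 0 (sqrt 2 * \<sigma>)))"
      using \<sigma> by (intro real_distribution_normal) simp
    fix t
    let ?\<phi> = "char (density lborel (normal_density 0 \<sigma>)) (sqrt 2 * t)"
    define avg where "avg z l m = (\<Sum>u\<in>words_from A l m. iexp (t * Y m z u)) / card (words_from A l m)" for z l m
    have char_eq: "char (displacement_distr act b lam (S m) (k + 2 * m)) t = (\<Sum>z\<in>Z. \<Sum>l\<in>L z. avg z l m) / of_nat N"
      if m: "m > 0" for m
    proof -
      have "char (displacement_distr act b lam (S m) (k + 2 * m)) t = 
         (\<Sum>x\<in>S m. iexp (t * ((dist b (act x b) - lam * real (k + 2 * m)) / sqrt (real (k + 2 * m))))) / card (S m)"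
        unfolding displacement_distr_def using finS by (rule char_uniform)
      also have "\<dots> = (\<Sum>(z, u)\<in>J m. iexp (t * Y m z u)) / card (J m)"
        unfolding sum.reindex_bij_betw[OF bij[of m], symmetric] bij_betw_same_card[OF bij[of m]]
        by (simp add: Y_def disp_def case_prod_beta)
      also have "\<dots> = (\<Sum>z\<in>Z. \<Sum>l\<in>L z. \<Sum>u\<in>words_from A l m. iexp (t * Y m z u)) / of_nat (N * q ^ (m - 1))"
        by (simp add: sumJ[OF m] cardJ[OF m])
      also have "(\<Sum>z\<in>Z. \<Sum>l\<in>L z. \<Sum>u\<in>words_from A l m. iexp (t * Y m z u)) / of_nat (N * q ^ (m - 1)) =
         (\<Sum>z\<in>Z. \<Sum>l\<in>L z. avg z l m) / of_nat N"
      proof -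
        have "(\<Sum>z\<in>Z. \<Sum>l\<in>L z. avg z l m) =
            (\<Sum>z\<in>Z. \<Sum>l\<in>L z. (\<Sum>u\<in>words_from A l m. iexp (t * Y m z u)) / of_nat (q ^ (m - 1)))"
          by (intro sum.cong refl) (simp add: avg_def cardwf m L_def)
        then show ?thesis by (simp add: mult.commute flip: sum_divide_distrib)
      qed
      finally show ?thesis .
    qed
    have "avg z l \<longlonglongrightarrow> ?\<phi>" if z: "z \<in> Z" and l: "l \<in> L z" for z l
    proof -
      have lA: "l \<in> A \<times> UNIV" using l by (simp add: L_def)
      let ?a = "\<lambda>m. (\<Sum>u\<in>words_from A l m. iexp ((sqrt 2 * t) * X m u)) / card (words_from A l m)"
      have "eventually (\<lambda>m. norm (avg z l m - ?a m) \<le> \<bar>t\<bar> * \<epsilon> m) sequentially"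
        using eventually_gt_at_top[of 0]
      proof eventually_elim
        case (elim m)
        have "avg z l m - ?a m =
          (\<Sum>u\<in>words_from A l m. iexp (t * Y m z u) - iexp ((sqrt 2 * t) * X m u)) / card (words_from A l m)"
          by (simp add: avg_def sum_subtractf diff_divide_distrib)
        also have "norm \<dots> \<le> (\<Sum>u\<in>words_from A l m. \<bar>t\<bar> * \<epsilon> m) / card (words_from A l m)"
          unfolding norm_divide norm_of_nat
        proof (intro divide_right_mono sum_norm_le)
          fix u assume u: "u \<in> words_from A l m"
          then have "(z, u) \<in> J m" unfolding JL[OF elim] using z l by blast
          then have "\<bar>t\<bar> * \<bar>Y m z u - sqrt 2 * X m u\<bar> \<le> \<bar>t\<bar> * \<epsilon> m"
            using YX elim by (intro mult_left_mono) auto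
          also have "\<bar>t\<bar> * \<bar>Y m z u - sqrt 2 * X m u\<bar> = \<bar>t * Y m z u - (sqrt 2 * t) * X m u\<bar>"
            by (simp add: algebra_simps flip: abs_mult)
          finally show "norm (iexp (t * Y m z u) - iexp ((sqrt 2 * t) * X m u)) \<le> \<bar>t\<bar> * \<epsilon> m"
            using norm_iexp_diff_le order_trans by blast
        qed simp
        also have "\<dots> = \<bar>t\<bar> * \<epsilon> m" using card_words_from_pos[OF p lA elim] by simp
        finally show ?case .
      qed
      moreover have "(\<lambda>m. \<bar>t\<bar> * \<epsilon> m) \<longlonglongrightarrow> 0" using \<epsilon>0 by (rule tendsto_mult_right_zero)
      ultimately have "(\<lambda>m. avg z l m - ?a m) \<longlonglongrightarrow> 0" by (rule Lim_null_comparison)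
      from tendsto_add[OF this fl[OF lA, of "sqrt 2 * t"]] show ?thesis by simp
    qed
    then have "(\<lambda>m. (\<Sum>z\<in>Z. \<Sum>l\<in>L z. avg z l m) / of_nat N) \<longlonglongrightarrow> (\<Sum>z\<in>Z. \<Sum>l\<in>L z. ?\<phi>) / of_nat N"
      using N by (intro tendsto_divide tendsto_sum tendsto_const) auto
    also have "(\<Sum>z\<in>Z. \<Sum>l\<in>L z. ?\<phi>) = of_nat N * ?\<phi>"
      by (simp add: N_def flip: sum_distrib_right)
    also have "of_nat N * ?\<phi> / of_nat N = ?\<phi>" using N by simp
    finally have "(\<lambda>m. (\<Sum>z\<in>Z. \<Sum>l\<in>L z. avg z l m) / of_nat N) \<longlonglongrightarrow> ?\<phi>" .
    then have "(\<lambda>m. char (displacement_distr act b lam (S m) (k + 2 * m)) t) \<longlonglongrightarrow> ?\<phi>"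
      by (rule Lim_transform_eventually)
         (use char_eq in \<open>auto intro!: eventually_mono[OF eventually_gt_at_top[of 0]]\<close>)
    then show "(\<lambda>m. char (displacement_distr act b lam (S m) (k + 2 * m)) t) \<longlonglongrightarrow>
        char (density lborel (normal_density 0 (sqrt 2 * \<sigma>))) t"
      using \<sigma> by (simp add: char_normal_scale)
  qed
qed

end

theorem theorem1p2:
  fixes G :: "('g, 'b) monoid_scheme" and A :: "'g set" and p k :: nat
    and act :: "'g \<Rightarrow> 'x::metric_space \<Rightarrow> 'x" and b :: 'x
    and lam \<sigma> :: real and \<CC> :: "'g set"
  assumes "group G"
    and "free_generating_set G A" and "finite A" and "card A = p" and "p \<ge> 2"
    and "CAT_minus_one TYPE('x)"
    and "isometric_action G act"
    and "properly_discontinuous G act"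
    and "convex_cocompact G act b"
    and "(\<lambda>n. 1 / real (card (word_sphere G A n)) *
            (\<Sum>x\<in>word_sphere G A n. dist b (act x b) / real n)) \<longlonglongrightarrow> lam"
    and "lam > 0"
    and "\<not> bounded {dist b (act x b) - lam * real (word_length G A x) | x. x \<in> carrier G}"
    and "\<sigma> > 0"
    and "weak_conv_m (\<lambda>n. displacement_distr act b lam (word_sphere G A n) n)
           (density lborel (normal_density 0 \<sigma>))"
    and "\<CC> \<in> conjugacy_classes G" and "\<CC> \<noteq> {\<one>\<^bsub>G\<^esub>}"
    and "k = (LEAST n. \<exists>x\<in>\<CC>. word_length G A x = n)"
  shows "weak_conv_m
           (\<lambda>m. displacement_distr act b lam (\<CC> \<inter> word_sphere G A (k + 2 * m)) (k + 2 * m))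
           (density lborel (normal_density 0 (sqrt (2 * \<sigma>\<^sup>2)))) \<and>
         (\<forall>y. (\<lambda>m. 1 / real (card (\<CC> \<inter> word_sphere G A (k + 2 * m))) *
                 real (card {x \<in> \<CC> \<inter> word_sphere G A (k + 2 * m).
                   (dist b (act x b) - lam * real (k + 2 * m)) / sqrt (real (k + 2 * m)) < y}))
              \<longlonglongrightarrow> 1 / (2 * sqrt pi * \<sigma>) *
                 (LINT t:{..y}|lborel. exp (- (t\<^sup>2 / (4 * \<sigma>\<^sup>2)))))"
proof -
  interpret group G by fact
  interpret free_isometric_action G act A b
    by unfold_locales (use assms in auto)
  define S where "S m = \<CC> \<inter> word_sphere G A (k + 2 * m)" for m
  have p: "card A \<ge> 2" using assms by simp
  note clt = conjugacy_class_clt[OF p assms(6,8,9,13,14,15,16,17), folded S_def]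
  have sq: "sqrt (2 * \<sigma>\<^sup>2) = sqrt 2 * \<sigma>" using assms(13) by (simp add: real_sqrt_mult)
  have s0: "sqrt 2 * \<sigma> > 0" using assms(13) by simp
  have wc: "weak_conv_m (\<lambda>m. displacement_distr act b lam (S m) (k + 2 * m))
           (density lborel (normal_density 0 (sqrt 2 * \<sigma>)))" by (rule clt(3))
  have "(\<lambda>m. 1 / real (card (S m)) * real (card {x \<in> S m.
             (dist b (act x b) - lam * real (k + 2 * m)) / sqrt (real (k + 2 * m)) < y}))
        \<longlonglongrightarrow> 1 / (2 * sqrt pi * \<sigma>) * (LINT t:{..y}|lborel. exp (- (t\<^sup>2 / (4 * \<sigma>\<^sup>2))))" for y
  proof -
    \<comment> \<open>the open half-line is a continuity set of the limit law, which gives the strict inequality\<close>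
    have "(\<lambda>m. measure (displacement_distr act b lam (S m) (k + 2 * m)) {..<y}) \<longlonglongrightarrow>
        measure (density lborel (normal_density 0 (sqrt 2 * \<sigma>))) {..<y}"
    proof (rule weak_conv_imp_continuity_set_conv[OF _ _ wc])
      show "real_distribution (displacement_distr act b lam (S m) (k + 2 * m))" for m
        unfolding displacement_distr_def using clt(1,2) by (intro real_distribution_uniform)
      have "frontier {..<y} = {y}" by (auto simp: frontier_def interior_open)
      then show "emeasure (density lborel (normal_density 0 (sqrt 2 * \<sigma>))) (frontier {..<y}) = 0"
        using measure_normal_lessThan(2)[OF s0] by simp
    qed (use s0 in \<open>auto intro: real_distribution_normal\<close>)
    also have "measure (density lborel (normal_density 0 (sqrt 2 * \<sigma>))) {..<y} =
        1 / (2 * sqrt pi * \<sigma>) * (LINT t:{..y}|lborel. exp (- (t\<^sup>2 / (4 * \<sigma>\<^sup>2))))"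
      unfolding measure_normal_lessThan(1)[OF s0]
      by (simp add: real_sqrt_mult power_mult_distrib mult_ac)
    finally show ?thesis
      using clt(1) by (simp add: displacement_distr_def measure_uniform)
  qed
  then show ?thesis using wc unfolding sq S_def by blast
qed

end
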